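(* Let $v$ be a flow on a compact metric space $X$. Then the Morse graph $G_v$ of $v$ is a quotient space of the abstract weak orbit space $X/[v]$, of the weak orbit class space $X/\check v$, and of the orbit class space $X/\hat v$, with the pre-orders $\leq_\alpha$ and $\leq_\omega$.
   Context: A flow on a topological space $X$ is a continuous $\mathbb{R}$-action $v:\mathbb{R}\times X\to X$, $v_t=v(t,\cdot)$; $O(x)=\{v_t(x): t\in\mathbb{R}\}$. Limit sets: $\omega(x)=\bigcap_{n\in\mathbb{R}}\overline{\{v_t(x): t>n\}}$, $\alpha(x)=\bigcap_{n\in\mathbb{R}}\overline{\{v_t(x): t<n\}}$. A point $x$ is singular if $v_t(x)=x$ for all $t$, and periodic if there is $T>0$ with $v_T(x)=x$ and $v_t(x)\ne x$ for $t\in(0,T)$. $\mathrm{Sing}(v)$, $\mathrm{Per}(v)$ denote the sets of singular and periodic points, and $\mathrm{Cl}(v)=\mathrm{Sing}(v)\sqcup\mathrm{Per}(v)$. A point $x$ is recurrent if $x\in\alpha(x)\cup\omega(x)$. $\mathrm{R}(v)$ is the set of recurrent points not in $\mathrm{Cl}(v)$ and $\mathrm{P}(v)$ is the set of non-recurrent points. Decompositions: $\alpha'(x)=\alpha(x)\setminus O(x)$, $\omega'(x)=\omega(x)\setminus O(x)$. $[x]'$ is the connected component containing $x$ of $\{y\in X:\alpha'(y)=\alpha'(x),\ \omega'(y)=\omega'(x)\}$. $[x]''$ is the connected component containing $x$ of $[x]'\cap Z$, where $Z$ is the one of $\mathrm{Sing}(v),\mathrm{Per}(v),\mathrm{P}(v),\mathrm{R}(v)$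 containing $x$. The orbit class is $\hat O(x)=\{y:\overline{O(y)}=\overline{O(x)}\}$; the weak orbit class is $\check O(x)=\{y:\overline{O(y)}=\overline{O(x)},\ \alpha(y)=\alpha(x),\ \omega(y)=\omega(x)\}$; the abstract weak orbit is $[x]=[x]''$ if $x\notin\mathrm{R}(v)$ and $[x]=\check O(x)$ if $x\in\mathrm{R}(v)$. Each of the families $\{\hat O(x)\}$, $\{\check O(x)\}$, $\{[x]\}$ is a partition of $X$; the corresponding quotient spaces are $X/\hat v$, $X/\check v$, $X/[v]$. For two elements $A,B$ of one of these partitions, $A\leq_\alpha B$ if $A=B$ or $a\in\alpha(b)$ for some $a\in A$, $b\in B$, and $A\leq_\omega B$ if $A=B$ or $a\in\omega(b)$ for some $a\in A$, $b\in B$. Morse graph: let $d$ be the metric of $X$. For $\varepsilon>0$, $T>0$, an $(\varepsilon,T)$-chain from $x$ to $y$ consists of points $x=x_0,\dots,x_{k+1}=y$ and times $t_0,\dots,t_k>T$ with $d(v_{t_i}(x_i),x_{i+1})<\varepsilon$ for $0\le i\le k$. A point $x$ is chain recurrent if for all $\varepsilon,T>0$ there is an $(\varepsilon,T)$-chain from $x$ to $x$; $CR(v)$ is the set of chain recurrent points. The Morse sets $M_i$ are the connected components of $CR(v)$. For $j\neq k$ the connecting orbit set is $D_{j,k}=\{x\in X:\alpha(x)\subseteq M_j,\ \omega(x)\subseteq M_k\}$, and $X\setminus\bigsqcup_i M_i=\bigsqcup_{j\ne k} D_{j,k}$. The Morse graph $G_v$ is the directed graph with vertex set $\{M_i\}$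 and directed edge set $\{(M_j,M_k): D_{j,k}\ne\emptyset\}$; it is regarded as a quotient space of $X$ (obtained from the decomposition of $X$ into the vertices $M_i$ and the nonempty connecting orbit sets $D_{j,k}$) with a directed structure. *)

theory Defs
  imports
    "HOL-Analysis.Analysis"
    "HOL-Library.Disjoint_Sets"
    "Graph_Theory.Pair_Digraph"
begin

section \<open>Flows and limit sets\<close>

definition flow_on :: "'a topology \<Rightarrow> (real \<Rightarrow> 'a \<Rightarrow> 'a) \<Rightarrow> bool" where
  "flow_on X v \<longleftrightarrow>
     continuous_map (prod_topology euclideanreal X) X (\<lambda>(t, x). v t x) \<and>
     (\<forall>x\<in>topspace X. v 0 x = x) \<and>
     (\<forall>s t. \<forall>x\<in>topspace X. v (s + t) x = v s (v t x))"

definition flow_orbit :: "(real \<Rightarrow> 'a \<Rightarrow> 'a) \<Rightarrow> 'a \<Rightarrow> 'a set" where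
  "flow_orbit v x = range (\<lambda>t. v t x)"

definition omega_limit :: "'a topology \<Rightarrow> (real \<Rightarrow> 'a \<Rightarrow> 'a) \<Rightarrow> 'a \<Rightarrow> 'a set" where
  "omega_limit X v x = (\<Inter>n::real. X closure_of {v t x |t. t > n})"

definition alpha_limit :: "'a topology \<Rightarrow> (real \<Rightarrow> 'a \<Rightarrow> 'a) \<Rightarrow> 'a \<Rightarrow> 'a set" where
  "alpha_limit X v x = (\<Inter>n::real. X closure_of {v t x |t. t < n})"

definition singular_points :: "'a topology \<Rightarrow> (real \<Rightarrow> 'a \<Rightarrow> 'a) \<Rightarrow> 'a set" where
  "singular_points X v = {x \<in> topspace X. \<forall>t. v t x = x}"

definition periodic_points :: "'a topology \<Rightarrow> (real \<Rightarrow> 'a \<Rightarrow> 'a) \<Rightarrow> 'a set" where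
  "periodic_points X v =
     {x \<in> topspace X. \<exists>T>0. v T x = x \<and> (\<forall>t. 0 < t \<and> t < T \<longrightarrow> v t x \<noteq> x)}"

definition closed_orbit_points :: "'a topology \<Rightarrow> (real \<Rightarrow> 'a \<Rightarrow> 'a) \<Rightarrow> 'a set" where
  "closed_orbit_points X v = singular_points X v \<union> periodic_points X v"

definition recurrent_points :: "'a topology \<Rightarrow> (real \<Rightarrow> 'a \<Rightarrow> 'a) \<Rightarrow> 'a set" where
  "recurrent_points X v = {x \<in> topspace X. x \<in> alpha_limit X v x \<union> omega_limit X v x}"

text \<open>The sets \<open>R(v)\<close> and \<open>P(v)\<close>.\<close>

definition nonclosed_recurrent_points :: "'a topology \<Rightarrow> (real \<Rightarrow> 'a \<Rightarrow> 'a) \<Rightarrow> 'a set" where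
  "nonclosed_recurrent_points X v = recurrent_points X v - closed_orbit_points X v"

definition nonrecurrent_points :: "'a topology \<Rightarrow> (real \<Rightarrow> 'a \<Rightarrow> 'a) \<Rightarrow> 'a set" where
  "nonrecurrent_points X v = topspace X - recurrent_points X v"

section \<open>Orbit classes, weak orbit classes and abstract weak orbits\<close>

definition alpha_limit' :: "'a topology \<Rightarrow> (real \<Rightarrow> 'a \<Rightarrow> 'a) \<Rightarrow> 'a \<Rightarrow> 'a set" where
  "alpha_limit' X v x = alpha_limit X v x - flow_orbit v x"

definition omega_limit' :: "'a topology \<Rightarrow> (real \<Rightarrow> 'a \<Rightarrow> 'a) \<Rightarrow> 'a \<Rightarrow> 'a set" where
  "omega_limit' X v x = omega_limit X v x - flow_orbit v x"

text \<open>\<open>[x]'\<close>\<close>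

definition limit_component :: "'a topology \<Rightarrow> (real \<Rightarrow> 'a \<Rightarrow> 'a) \<Rightarrow> 'a \<Rightarrow> 'a set" where
  "limit_component X v x =
     connected_component_of_set
       (subtopology X {y \<in> topspace X. alpha_limit' X v y = alpha_limit' X v x \<and>
                                       omega_limit' X v y = omega_limit' X v x}) x"

definition recurrence_stratum :: "'a topology \<Rightarrow> (real \<Rightarrow> 'a \<Rightarrow> 'a) \<Rightarrow> 'a \<Rightarrow> 'a set" where
  "recurrence_stratum X v x =
     (if x \<in> singular_points X v then singular_points X v
      else if x \<in> periodic_points X v then periodic_points X v
      else if x \<in> nonrecurrent_points X v then nonrecurrent_points X v
      else nonclosed_recurrent_points X v)"

text \<open>\<open>[x]''\<close>\<close>

definition limit_stratum_component :: "'a topology \<Rightarrow> (real \<Rightarrow> 'a \<Rightarrow> 'a) \<Rightarrow> 'a \<Rightarrow> 'a set" where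
  "limit_stratum_component X v x =
     connected_component_of_set
       (subtopology X (limit_component X v x \<inter> recurrence_stratum X v x)) x"

definition orbit_class :: "'a topology \<Rightarrow> (real \<Rightarrow> 'a \<Rightarrow> 'a) \<Rightarrow> 'a \<Rightarrow> 'a set" where
  "orbit_class X v x =
     {y \<in> topspace X. X closure_of flow_orbit v y = X closure_of flow_orbit v x}"

definition weak_orbit_class :: "'a topology \<Rightarrow> (real \<Rightarrow> 'a \<Rightarrow> 'a) \<Rightarrow> 'a \<Rightarrow> 'a set" where
  "weak_orbit_class X v x =
     {y \<in> topspace X. X closure_of flow_orbit v y = X closure_of flow_orbit v x \<and>
        alpha_limit X v y = alpha_limit X v x \<and> omega_limit X v y = omega_limit X v x}"

definition abstract_weak_orbit :: "'a topology \<Rightarrow> (real \<Rightarrow> 'a \<Rightarrow> 'a) \<Rightarrow> 'a \<Rightarrow> 'a set" where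
  "abstract_weak_orbit X v x =
     (if x \<in> nonclosed_recurrent_points X v then weak_orbit_class X v x
      else limit_stratum_component X v x)"

definition orbit_classes :: "'a topology \<Rightarrow> (real \<Rightarrow> 'a \<Rightarrow> 'a) \<Rightarrow> 'a set set" where
  "orbit_classes X v = orbit_class X v ` topspace X"

definition weak_orbit_classes :: "'a topology \<Rightarrow> (real \<Rightarrow> 'a \<Rightarrow> 'a) \<Rightarrow> 'a set set" where
  "weak_orbit_classes X v = weak_orbit_class X v ` topspace X"

definition abstract_weak_orbits :: "'a topology \<Rightarrow> (real \<Rightarrow> 'a \<Rightarrow> 'a) \<Rightarrow> 'a set set" where
  "abstract_weak_orbits X v = abstract_weak_orbit X v ` topspace X"

text \<open>The relations \<open>\<le>\<^sub>\<alpha>\<close> and \<open>\<le>\<^sub>\<omega>\<close> on a family \<open>P\<close> of subsets, as sets of pairs.\<close>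

definition le_alpha :: "'a topology \<Rightarrow> (real \<Rightarrow> 'a \<Rightarrow> 'a) \<Rightarrow> 'a set set \<Rightarrow> 'a set rel" where
  "le_alpha X v P =
     {(A, B) \<in> P \<times> P. A = B \<or> (\<exists>a\<in>A. \<exists>b\<in>B. a \<in> alpha_limit X v b)}"

definition le_omega :: "'a topology \<Rightarrow> (real \<Rightarrow> 'a \<Rightarrow> 'a) \<Rightarrow> 'a set set \<Rightarrow> 'a set rel" where
  "le_omega X v P =
     {(A, B) \<in> P \<times> P. A = B \<or> (\<exists>a\<in>A. \<exists>b\<in>B. a \<in> omega_limit X v b)}"

section \<open>Decomposition spaces\<close>

text \<open>The quotient topology on a partition \<open>P\<close> of \<open>topspace X\<close>; the points of the quotient
  space are the members of \<open>P\<close>. The defining predicate is a topology only if the members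
  of \<open>P\<close> are pairwise disjoint.\<close>

definition decomposition_space :: "'a topology \<Rightarrow> 'a set set \<Rightarrow> 'a set topology" where
  "decomposition_space X P = topology (\<lambda>U. U \<subseteq> P \<and> openin X (\<Union>U))"

lemma openin_decomposition_space:
  assumes "partition_on (topspace X) P"
  shows "openin (decomposition_space X P) U \<longleftrightarrow> U \<subseteq> P \<and> openin X (\<Union>U)"
proof -
  have inter: "\<Union>(U \<inter> V) = \<Union>U \<inter> \<Union>V" if "U \<subseteq> P" "V \<subseteq> P" for U V
  proof
    show "\<Union>U \<inter> \<Union>V \<subseteq> \<Union>(U \<inter> V)"
    proof
      fix x assume "x \<in> \<Union>U \<inter> \<Union>V"
      then obtain A B where AB: "A \<in> U" "x \<in> A" "B \<in> V" "x \<in> B" by blast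
      then have "A = B"
        using that disjointD[OF partition_onD2[OF assms], of A B] by blast
      with AB show "x \<in> \<Union>(U \<inter> V)" by blast
    qed
  qed blast
  have "istopology (\<lambda>U. U \<subseteq> P \<and> openin X (\<Union>U))"
    unfolding istopology_def
  proof (intro conjI allI impI; (elim conjE)?)
    fix U V assume "U \<subseteq> P" "openin X (\<Union>U)" "V \<subseteq> P" "openin X (\<Union>V)"
    then show "U \<inter> V \<subseteq> P" "openin X (\<Union>(U \<inter> V))"
      by (blast, simp only: inter openin_Int)
  next
    fix K assume K: "\<forall>U\<in>K. U \<subseteq> P \<and> openin X (\<Union>U)"
    then show "\<Union>K \<subseteq> P" by blast
    have "\<Union>(\<Union>K) = \<Union>(Union ` K)" by blast
    also have "openin X \<dots>" using K by (intro openin_Union) blast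
    finally show "openin X (\<Union>(\<Union>K))" .
  qed
  then show ?thesis by (simp only: decomposition_space_def topology_inverse')
qed

lemma topspace_decomposition_space:
  assumes "partition_on (topspace X) P"
  shows "topspace (decomposition_space X P) = P"
proof
  show "topspace (decomposition_space X P) \<subseteq> P"
    unfolding topspace_def openin_decomposition_space[OF assms] by blast
  have "openin (decomposition_space X P) P"
    unfolding openin_decomposition_space[OF assms] partition_onD1[OF assms, symmetric] by simp
  then show "P \<subseteq> topspace (decomposition_space X P)" by (rule openin_subset)
qed

lemma quotient_map_decomposition_space:
  assumes P: "partition_on (topspace X) P"
    and p: "\<And>x. x \<in> topspace X \<Longrightarrow> p x \<in> P \<and> x \<in> p x"
  shows "quotient_map X (decomposition_space X P) p"
proof -
  have top: "x \<in> topspace X" if "x \<in> A" "A \<in> P" for x A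
    using that partition_onD1[OF P] by blast
  have uniq: "p x = A" if "x \<in> A" "A \<in> P" for x A
    using that p[OF top[OF that]] disjointD[OF partition_onD2[OF P], of "p x" A] by blast
  have "P \<subseteq> p ` topspace X"
  proof
    fix A assume A: "A \<in> P"
    then have "A \<noteq> {}" using partition_onD3[OF P] by blast
    then obtain x where x: "x \<in> A" by blast
    then show "A \<in> p ` topspace X"
      using uniq[OF x A] top[OF x A] by blast
  qed
  then have "p ` topspace X = P" using p by blast
  moreover have "{x \<in> topspace X. p x \<in> U} = \<Union>U" if "U \<subseteq> P" for U
  proof
    show "{x \<in> topspace X. p x \<in> U} \<subseteq> \<Union>U" using p by blast
    show "\<Union>U \<subseteq> {x \<in> topspace X. p x \<in> U}"
    proof
      fix x assume "x \<in> \<Union>U"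
      then obtain A where A: "A \<in> U" "x \<in> A" by blast
      then have "A \<in> P" using that by blast
      then show "x \<in> {x \<in> topspace X. p x \<in> U}"
        using uniq[OF A(2)] top[OF A(2)] A(1) by simp
    qed
  qed
  ultimately show ?thesis
    by (simp add: quotient_map_def topspace_decomposition_space[OF P]
        openin_decomposition_space[OF P])
qed

section \<open>Chain recurrence and the Morse graph\<close>

definition eps_chain ::
  "'a set \<Rightarrow> ('a \<Rightarrow> 'a \<Rightarrow> real) \<Rightarrow> (real \<Rightarrow> 'a \<Rightarrow> 'a) \<Rightarrow> real \<Rightarrow> real \<Rightarrow> 'a \<Rightarrow> 'a \<Rightarrow> bool" where
  "eps_chain S d v \<epsilon> T x y \<longleftrightarrow>
     (\<exists>(k::nat) p t. p 0 = x \<and> p (Suc k) = y \<and> (\<forall>i\<le>Suc k. p i \<in> S) \<and>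
        (\<forall>i\<le>k. t i > T \<and> d (v (t i) (p i)) (p (Suc i)) < \<epsilon>))"

definition chain_recurrent_points ::
  "'a set \<Rightarrow> ('a \<Rightarrow> 'a \<Rightarrow> real) \<Rightarrow> (real \<Rightarrow> 'a \<Rightarrow> 'a) \<Rightarrow> 'a set" where
  "chain_recurrent_points S d v = {x \<in> S. \<forall>\<epsilon>>0. \<forall>T>0. eps_chain S d v \<epsilon> T x x}"

definition morse_sets ::
  "'a set \<Rightarrow> ('a \<Rightarrow> 'a \<Rightarrow> real) \<Rightarrow> (real \<Rightarrow> 'a \<Rightarrow> 'a) \<Rightarrow> 'a set set" where
  "morse_sets S d v =
     connected_components_of
       (subtopology (Metric_space.mtopology S d) (chain_recurrent_points S d v))"

definition connecting_orbit_set ::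
  "'a topology \<Rightarrow> (real \<Rightarrow> 'a \<Rightarrow> 'a) \<Rightarrow> 'a set \<Rightarrow> 'a set \<Rightarrow> 'a set" where
  "connecting_orbit_set X v M N =
     {x \<in> topspace X. alpha_limit X v x \<subseteq> M \<and> omega_limit X v x \<subseteq> N}"

definition morse_graph ::
  "'a set \<Rightarrow> ('a \<Rightarrow> 'a \<Rightarrow> real) \<Rightarrow> (real \<Rightarrow> 'a \<Rightarrow> 'a) \<Rightarrow> 'a set pair_pre_digraph" where
  "morse_graph S d v =
     \<lparr> pverts = morse_sets S d v,
       parcs = {(M, N). M \<in> morse_sets S d v \<and> N \<in> morse_sets S d v \<and> M \<noteq> N \<and>
                 connecting_orbit_set (Metric_space.mtopology S d) v M N \<noteq> {}} \<rparr>"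

text \<open>The subset of the phase space represented by a vertex (left summand) or by a directed
  edge (right summand) of the Morse graph.\<close>

definition morse_cell ::
  "'a topology \<Rightarrow> (real \<Rightarrow> 'a \<Rightarrow> 'a) \<Rightarrow> 'a set + 'a set \<times> 'a set \<Rightarrow> 'a set" where
  "morse_cell X v = case_sum (\<lambda>M. M) (\<lambda>(M, N). connecting_orbit_set X v M N)"

definition morse_cells ::
  "'a set \<Rightarrow> ('a \<Rightarrow> 'a \<Rightarrow> real) \<Rightarrow> (real \<Rightarrow> 'a \<Rightarrow> 'a) \<Rightarrow> 'a set set" where
  "morse_cells S d v =
     morse_cell (Metric_space.mtopology S d) v `
       (pverts (morse_graph S d v) <+> parcs (morse_graph S d v))"

definition morse_graph_space ::
  "'a set \<Rightarrow> ('a \<Rightarrow> 'a \<Rightarrow> real) \<Rightarrow> (real \<Rightarrow> 'a \<Rightarrow> 'a) \<Rightarrow> 'a set topology" where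
  "morse_graph_space S d v =
     decomposition_space (Metric_space.mtopology S d) (morse_cells S d v)"

text \<open>The directed structure on the points of the Morse graph: a cell is related to itself, and
  a vertex is related to each edge of which it is the tail (respectively the head).\<close>

definition morse_tail_rel ::
  "'a set \<Rightarrow> ('a \<Rightarrow> 'a \<Rightarrow> real) \<Rightarrow> (real \<Rightarrow> 'a \<Rightarrow> 'a) \<Rightarrow> 'a set rel" where
  "morse_tail_rel S d v =
     Id_on (morse_cells S d v) \<union>
     {(M, connecting_orbit_set (Metric_space.mtopology S d) v M N) |M N.
        (M, N) \<in> parcs (morse_graph S d v)}"

definition morse_head_rel ::
  "'a set \<Rightarrow> ('a \<Rightarrow> 'a \<Rightarrow> real) \<Rightarrow> (real \<Rightarrow> 'a \<Rightarrow> 'a) \<Rightarrow> 'a set rel" where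
  "morse_head_rel S d v =
     Id_on (morse_cells S d v) \<union>
     {(N, connecting_orbit_set (Metric_space.mtopology S d) v M N) |M N.
        (M, N) \<in> parcs (morse_graph S d v)}"

end

theory Submission
  imports Defs
begin

text \<open>
  A connected set of chain recurrent points is chain transitive, since the points reachable by
  \<open>(\<epsilon>, T)\<close>-chains form a relatively clopen subset. Limit sets are nonempty, connected and
  chain recurrent, so each lies in exactly one Morse set; if \<open>\<alpha>(x)\<close> and \<open>\<omega>(x)\<close> lie in the same one,
  then chaining from \<open>x\<close> through \<open>\<omega>(x)\<close> and \<open>\<alpha>(x)\<close> back to \<open>x\<close> shows that \<open>x\<close> is chain recurrent.
  Hence vertices and edges decompose the space. Each class lies in a single cell: outside the chain
  recurrent set the orbit class of \<open>x\<close> is just its orbit, because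
  the closure of \<open>O(x)\<close> is \<open>\<alpha>(x) \<union> O(x) \<union> \<omega>(x)\<close>, and a component \<open>[x]''\<close> is a connected set whose
  points are all recurrent or all have the same limit sets as \<open>x\<close>. So the quotient map onto the cells
  factors through each of the three class spaces.
\<close>

section \<open>Limit sets of continuous flows\<close>

text \<open>Two obstacles shape the proof. The steps of a chain have durations bounded only from
  below, so no continuity estimate is uniform over them. Where a neighbourhood of the new starting
  point must be fixed before the chain is known, the first step is cut at the fixed time
  \<open>T + 1\<close>; both pieces last longer than \<open>T\<close> if the step lasts longer than
  \<open>2 * T + 2\<close>, which is where this constant comes from. The other obstacle is [x]'':
  its members share limit sets only after each has lost its own orbit. Over P(v) nothing is lost, so
  the shared sets still determine the two Morse sets. Over closed orbits nothing remains, and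
  connectedness inside the chain recurrent set has to decide. The same loss must be absorbed when
  the pre-orders are shown to be transitive. Compactness of the space enters through limit sets: it
  makes them nonempty and connected.\<close>

lemma connectedin_INT_decseq:
  fixes C :: "nat \<Rightarrow> 'a set"
  assumes cpt: "compact_space X" and haus: "Hausdorff_space X"
    and clo: "\<And>n. closedin X (C n)" and con: "\<And>n. connectedin X (C n)" and dec: "decseq C"
  shows "connectedin X (\<Inter>n. C n)"
  unfolding connectedin_closedin
proof (intro conjI notI; (elim exE conjE)?)
  show "(\<Inter>n. C n) \<subseteq> topspace X"
    using clo[of 0] closedin_subset by blast
next
  fix E1 E2
  assume E: "closedin X E1" "closedin X E2" "(\<Inter>n. C n) \<subseteq> E1 \<union> E2" "E1 \<inter> E2 \<inter> (\<Inter>n. C n) = {}"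
    and ne: "E1 \<inter> (\<Inter>n. C n) \<noteq> {}" "E2 \<inter> (\<Inter>n. C n) \<noteq> {}"
  let ?K = "\<Inter>n. C n"
  have K: "closedin X ?K" using clo by blast
  have "compactin X (E1 \<inter> ?K)" "compactin X (E2 \<inter> ?K)"
    using E K cpt by (auto intro!: closedin_compact_space)
  moreover have "disjnt (E1 \<inter> ?K) (E2 \<inter> ?K)" using E by (auto simp: disjnt_def)
  ultimately obtain U V where UV: "openin X U" "openin X V" "E1 \<inter> ?K \<subseteq> U" "E2 \<inter> ?K \<subseteq> V" "disjnt U V"
    using haus unfolding Hausdorff_space_compact_sets by meson
  \<comment> \<open>If some \<open>D n\<close> were empty, the disjoint open sets \<open>U\<close>
    and \<open>V\<close> would separate the connected set \<open>C n\<close>. So the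
    \<open>D n\<close> are nested, closed and nonempty, and compactness gives a common point; it
    lies in the intersection of the \<open>C n\<close> but outside \<open>U\<close> and
    \<open>V\<close>, which cover that intersection.\<close>
  define D where "D n = C n - (U \<union> V)" for n
  have "D n \<noteq> {}" for n
  proof
    assume "D n = {}"
    then have "C n \<subseteq> U \<union> V" by (auto simp: D_def)
    moreover have "U \<inter> C n \<noteq> {}" "V \<inter> C n \<noteq> {}" using ne UV by blast+
    moreover have "U \<inter> V \<inter> C n = {}" using UV(5) by (auto simp: disjnt_def)
    ultimately show False using connectedinD[OF con UV(1,2)] by blast
  qed
  moreover have "closedin X (D n)" for n
    unfolding D_def using clo UV by (intro closedin_diff openin_Un)
  moreover have "decseq D" using dec by (fastforce simp: decseq_def D_def)
  ultimately have "(\<Inter>n. D n) \<noteq> {}" by (intro compact_space_imp_nest[OF cpt])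
  then show False using UV E(3) by (auto simp: D_def)
qed

lemma INT_surj: "surj f \<Longrightarrow> (\<Inter>n. F (f n)) = (\<Inter>n. F n)"
  by (simp only: image_image[of F f UNIV, symmetric])

text \<open>Together with \<open>topological_flow_reversed\<close> this yields the topological facts
  on \<alpha>-limit sets from those on \<omega>-limit sets. Chain arguments get no such symmetry,
  because chains only run forward in time.\<close>

lemma alpha_limit_eq_omega_limit_reversed:
  "alpha_limit X v = omega_limit X (\<lambda>t. v (- t))"
proof
  fix x
  have eq: "{v t x |t. t < - n} = {v (- t) x |t. t > n}" for n
  proof (intro antisym subsetI)
    fix y assume "y \<in> {v t x |t. t < - n}"
    then obtain t where "y = v (- (- t)) x" "- t > n" by auto
    then show "y \<in> {v (- t) x |t. t > n}" by blast
  qed force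
  have "(\<Inter>n. X closure_of {v t x |t. t < n}) = (\<Inter>n. X closure_of {v t x |t. t < - n})"
    by (rule INT_surj[symmetric, OF surjI[of _ uminus]]) simp
  then show "alpha_limit X v x = omega_limit X (\<lambda>t. v (- t)) x"
    by (simp add: alpha_limit_def omega_limit_def eq)
qed

lemma flow_orbit_reversed: "flow_orbit (\<lambda>t. v (- t)) x = flow_orbit v x"
proof -
  have "v t x = v (- (- t)) x" for t by simp
  then show ?thesis unfolding flow_orbit_def by blast
qed

locale topological_flow =
  fixes X :: "'a topology" and v :: "real \<Rightarrow> 'a \<Rightarrow> 'a"
  assumes flow: "flow_on X v"
begin

lemma flow_in_topspace: "x \<in> topspace X \<Longrightarrow> v t x \<in> topspace X"
  using flow unfolding flow_on_def by (auto simp: continuous_map_def Pi_iff)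

lemma flow_zero: "x \<in> topspace X \<Longrightarrow> v 0 x = x"
  using flow unfolding flow_on_def by blast

lemma flow_add: "x \<in> topspace X \<Longrightarrow> v (s + t) x = v s (v t x)"
  using flow unfolding flow_on_def by blast

lemma flow_commute: "x \<in> topspace X \<Longrightarrow> v s (v t x) = v t (v s x)"
  by (metis flow_add add.commute)

lemma flow_minus: "x \<in> topspace X \<Longrightarrow> v (- t) (v t x) = x"
  using flow_add[of x "- t" t] by (simp add: flow_zero)

lemma continuous_map_flow_time: "continuous_map X X (v t)"
proof -
  have "continuous_map X X ((\<lambda>(t, x). v t x) \<circ> (\<lambda>x. (t, x)))"
    using flow unfolding flow_on_def
    by (intro continuous_map_compose[where X' = "prod_topology euclideanreal X"])
      (auto intro!: continuous_map_pairedI)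
  then show ?thesis by (simp add: o_def)
qed

lemma continuous_map_flow_orbit:
  assumes "x \<in> topspace X"
  shows "continuous_map euclideanreal X (\<lambda>t. v t x)"
proof -
  have "continuous_map euclideanreal X ((\<lambda>(t, x). v t x) \<circ> (\<lambda>t. (t, x)))"
    using flow assms unfolding flow_on_def
    by (intro continuous_map_compose[where X' = "prod_topology euclideanreal X"])
      (auto intro!: continuous_map_pairedI)
  then show ?thesis by (simp add: o_def)
qed

lemma topological_flow_reversed: "topological_flow X (\<lambda>t. v (- t))"
proof
  have "continuous_map (prod_topology euclideanreal X) X
      ((\<lambda>(t, x). v t x) \<circ> (\<lambda>p. (- fst p, snd p)))"
    using flow unfolding flow_on_def
    by (intro continuous_map_compose[where X' = "prod_topology euclideanreal X"])
      (auto intro!: continuous_map_pairedI continuous_map_snd continuous_map_minus continuous_map_fst)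
  then show "flow_on X (\<lambda>t. v (- t))"
    using flow_add[of _ "- _" "- _"] by (simp add: flow_on_def o_def case_prod_unfold flow_zero)
qed

lemma in_flow_orbit: "x \<in> topspace X \<Longrightarrow> x \<in> flow_orbit v x"
  unfolding flow_orbit_def by (metis flow_zero rangeI)

lemma flow_orbit_subset_topspace: "x \<in> topspace X \<Longrightarrow> flow_orbit v x \<subseteq> topspace X"
  unfolding flow_orbit_def using flow_in_topspace by blast

lemma flow_orbit_eq:
  assumes "x \<in> topspace X" "y \<in> flow_orbit v x"
  shows "flow_orbit v y = flow_orbit v x"
proof -
  obtain s where y: "y = v s x" using assms by (auto simp: flow_orbit_def)
  have "v t x = v (t - s) y" "v t y = v (t + s) x" for t
    using flow_add[OF assms(1), of t s] flow_add[OF assms(1), of "t - s" s] by (simp_all add: y)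
  then show ?thesis unfolding flow_orbit_def by blast
qed

lemma connectedin_flow_orbit:
  "x \<in> topspace X \<Longrightarrow> connectedin X (flow_orbit v x)"
  unfolding flow_orbit_def
  by (rule connectedin_continuous_map_image[OF continuous_map_flow_orbit]) auto

lemma closedin_omega_limit: "closedin X (omega_limit X v x)"
  unfolding omega_limit_def by (rule closedin_Inter) auto

lemma omega_limit_subset_topspace: "omega_limit X v x \<subseteq> topspace X"
  using closedin_omega_limit closedin_subset by blast

lemma omega_limit_subset_orbit_closure: "omega_limit X v x \<subseteq> X closure_of flow_orbit v x"
proof -
  have "X closure_of {v t x |t. t > 0} \<subseteq> X closure_of flow_orbit v x"
    by (rule closure_of_mono) (auto simp: flow_orbit_def)
  then show ?thesis unfolding omega_limit_def by blast
qed

lemma omega_limit_flow: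
  assumes "x \<in> topspace X"
  shows "omega_limit X v (v s x) = omega_limit X v x"
proof -
  have eq: "{v t (v s x) |t. t > n} = {v t x |t. t > n + s}" for n
  proof -
    have "v t (v s x) = v (t + s) x" for t using flow_add[OF assms] by simp
    moreover have "\<exists>t'. v t x = v (t' + s) x \<and> t' > n" if "t > n + s" for t
      using that by (intro exI[of _ "t - s"]) auto
    ultimately show ?thesis by (force simp: algebra_simps)
  qed
  have "(\<Inter>n. X closure_of {v t x |t. t > n + s}) = (\<Inter>n. X closure_of {v t x |t. t > n})"
    by (rule INT_surj[OF surjI[of _ "\<lambda>n. n - s"]]) simp
  then show ?thesis by (simp add: omega_limit_def eq)
qed

lemma flow_in_omega_limit:
  assumes "x \<in> topspace X" "y \<in> omega_limit X v x"
  shows "v s y \<in> omega_limit X v x"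
proof -
  have "v s y \<in> X closure_of {v t x |t. t > n}" for n
  proof -
    have "y \<in> X closure_of {v t x |t. t > n - s}"
      using assms unfolding omega_limit_def by blast
    then have "v s y \<in> X closure_of (v s ` {v t x |t. t > n - s})"
      using continuous_map_image_closure_subset[OF continuous_map_flow_time] by blast
    moreover have "v s ` {v t x |t. t > n - s} \<subseteq> {v t x |t. t > n}"
    proof
      fix z assume "z \<in> v s ` {v t x |t. t > n - s}"
      then obtain t where "z = v s (v t x)" "t > n - s" by blast
      then show "z \<in> {v t x |t. t > n}"
        using flow_add[OF assms(1), of s t] by (intro CollectI exI[of _ "s + t"]) auto
    qed
    ultimately show ?thesis using closure_of_mono by blast
  qed
  then show ?thesis unfolding omega_limit_def by blast
qed

lemma orbit_closure_subset_omega_limit: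
  assumes "x \<in> topspace X" "y \<in> omega_limit X v x"
  shows "X closure_of flow_orbit v y \<subseteq> omega_limit X v x"
  using flow_in_omega_limit[OF assms]
  by (intro closure_of_minimal closedin_omega_limit) (auto simp: flow_orbit_def)

text \<open>A point outside both limit sets misses the closures of a backward tail
  \<open>t < m\<close> and of a forward tail \<open>t > n\<close>. What remains of the orbit is a
  compact arc, which is closed in a Hausdorff space, so a point of the orbit closure must lie on
  that arc.\<close>

lemma orbit_closure_eq:
  assumes "Hausdorff_space X" "x \<in> topspace X"
  shows "X closure_of flow_orbit v x = alpha_limit X v x \<union> flow_orbit v x \<union> omega_limit X v x"
proof (intro antisym subsetI)
  fix y assume y: "y \<in> X closure_of flow_orbit v x"
  show "y \<in> alpha_limit X v x \<union> flow_orbit v x \<union> omega_limit X v x"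
  proof (rule ccontr)
    assume not: "\<not> ?thesis"
    obtain m n where mn: "y \<notin> X closure_of {v t x |t. t < m}" "y \<notin> X closure_of {v t x |t. t > n}"
      using not unfolding alpha_limit_def omega_limit_def by blast
    let ?K = "(\<lambda>t. v t x) ` {m..n}"
    have "compactin X ?K"
      by (rule image_compactin[OF _ continuous_map_flow_orbit[OF assms(2)]]) simp
    then have "closedin X ?K" using assms(1) compactin_imp_closedin by blast
    moreover have "flow_orbit v x \<subseteq> {v t x |t. t < m} \<union> {v t x |t. t > n} \<union> ?K"
      by (force simp: flow_orbit_def)
    then have "y \<in> X closure_of ({v t x |t. t < m} \<union> {v t x |t. t > n} \<union> ?K)"
      using y closure_of_mono by blast
    ultimately have "y \<in> ?K" using mn by (simp add: closure_of_closedin)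
    then show False using not by (auto simp: flow_orbit_def)
  qed
next
  interpret r: topological_flow X "\<lambda>t. v (- t)" by (rule topological_flow_reversed)
  fix y assume "y \<in> alpha_limit X v x \<union> flow_orbit v x \<union> omega_limit X v x"
  then show "y \<in> X closure_of flow_orbit v x"
    using omega_limit_subset_orbit_closure r.omega_limit_subset_orbit_closure
      closure_of_subset[OF flow_orbit_subset_topspace[OF assms(2)]]
    by (auto simp: alpha_limit_eq_omega_limit_reversed flow_orbit_reversed)
qed

text \<open>The closures of the forward tails shrink as the threshold grows, so natural thresholds
  suffice. The limit set is then a decreasing intersection of nonempty closed sets, each connected
  as the closure of the image of a half-line.\<close>

lemma
  assumes cpt: "compact_space X" and x: "x \<in> topspace X"
  shows omega_limit_nonempty: "omega_limit X v x \<noteq> {}"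
    and connectedin_omega_limit: "Hausdorff_space X \<Longrightarrow> connectedin X (omega_limit X v x)"
proof -
  let ?C = "\<lambda>n::nat. X closure_of {v t x |t. t > real n}"
  have img: "{v t x |t. t > a} = (\<lambda>t. v t x) ` {a<..}" for a by auto
  have anti: "X closure_of {v t x |t. t > b} \<subseteq> X closure_of {v t x |t. t > a}" if "a \<le> b" for a b
    using that by (intro closure_of_mono) force
  have eq: "omega_limit X v x = (\<Inter>n. ?C n)"
  proof
    have "(\<Inter>n. ?C n) \<subseteq> X closure_of {v t x |t. t > a}" for a
    proof -
      obtain n :: nat where "a \<le> real n" using real_arch_simple by blast
      then show ?thesis using anti by blast
    qed
    then show "(\<Inter>n. ?C n) \<subseteq> omega_limit X v x"
      unfolding omega_limit_def by (rule INT_greatest)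
  qed (auto simp: omega_limit_def)
  have "decseq ?C" using anti by (simp add: decseq_def)
  moreover have "?C n \<noteq> {}" for n
  proof -
    have "v (real n + 1) x \<in> {v t x |t. t > real n}" by force
    then show ?thesis
      using closure_of_subset[of "{v t x |t. t > real n}" X] flow_in_topspace[OF x] by blast
  qed
  ultimately show "omega_limit X v x \<noteq> {}"
    unfolding eq by (intro compact_space_imp_nest[OF cpt]) auto
  show "connectedin X (omega_limit X v x)" if "Hausdorff_space X"
    unfolding eq
  proof (rule connectedin_INT_decseq[OF cpt that _ _ \<open>decseq ?C\<close>])
    show "connectedin X (?C n)" for n
      unfolding img
      by (intro connectedin_closure_of connectedin_continuous_map_image[OF continuous_map_flow_orbit[OF x]])
        simp
  qed simp
qed

end

lemma partition_on_classes:
  assumes "\<And>x. x \<in> A \<Longrightarrow> x \<in> C x" "\<And>x. x \<in> A \<Longrightarrow> C x \<subseteq> A"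
    and "\<And>x y. x \<in> A \<Longrightarrow> y \<in> C x \<Longrightarrow> C y = C x"
  shows "partition_on A (C ` A)"
proof (rule partition_onI)
  show "\<Union> (C ` A) = A" using assms(1,2) by blast
  show "{} \<notin> C ` A" using assms(1) by force
  fix p q assume "p \<in> C ` A" "q \<in> C ` A" "p \<noteq> q"
  then obtain x y where xy: "x \<in> A" "y \<in> A" "p = C x" "q = C y" by blast
  have "p = q" if "z \<in> p" "z \<in> q" for z
    using assms(3)[OF xy(1), of z] assms(3)[OF xy(2), of z] xy that by simp
  then show "disjnt p q" using \<open>p \<noteq> q\<close> by (auto simp: disjnt_iff)
qed

lemma connected_component_of_set_eq:
  "y \<in> connected_component_of_set X x \<Longrightarrow> connected_component_of_set X y = connected_component_of_set X x"
  using connected_component_of_equiv[of X x y] by simp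

section \<open>The \<alpha>-limit counterparts, by time reversal\<close>

context topological_flow
begin

lemma flow_orbit_cases:
  assumes "y \<in> flow_orbit v x"
  obtains t where "y = v t x"
  using assms by (auto simp: flow_orbit_def)

lemma closedin_alpha_limit: "closedin X (alpha_limit X v x)"
  using topological_flow.closedin_omega_limit[OF topological_flow_reversed]
  by (simp add: alpha_limit_eq_omega_limit_reversed)

lemma alpha_limit_subset_topspace: "alpha_limit X v x \<subseteq> topspace X"
  using closedin_alpha_limit closedin_subset by blast

lemma alpha_limit_subset_orbit_closure: "alpha_limit X v x \<subseteq> X closure_of flow_orbit v x"
  using topological_flow.omega_limit_subset_orbit_closure[OF topological_flow_reversed]
  by (simp add: alpha_limit_eq_omega_limit_reversed flow_orbit_reversed)

lemma alpha_limit_flow: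
  assumes "x \<in> topspace X"
  shows "alpha_limit X v (v s x) = alpha_limit X v x"
  using topological_flow.omega_limit_flow[OF topological_flow_reversed assms, of "- s"]
  by (simp add: alpha_limit_eq_omega_limit_reversed)

lemma flow_in_alpha_limit:
  assumes "x \<in> topspace X" "y \<in> alpha_limit X v x"
  shows "v s y \<in> alpha_limit X v x"
  using topological_flow.flow_in_omega_limit[OF topological_flow_reversed, of x y "- s"] assms
  by (simp add: alpha_limit_eq_omega_limit_reversed)

lemma orbit_closure_subset_alpha_limit:
  assumes "x \<in> topspace X" "y \<in> alpha_limit X v x"
  shows "X closure_of flow_orbit v y \<subseteq> alpha_limit X v x"
  using topological_flow.orbit_closure_subset_omega_limit[OF topological_flow_reversed, of x y] assms
  by (simp add: alpha_limit_eq_omega_limit_reversed flow_orbit_reversed)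

lemma alpha_limit_nonempty:
  "compact_space X \<Longrightarrow> x \<in> topspace X \<Longrightarrow> alpha_limit X v x \<noteq> {}"
  using topological_flow.omega_limit_nonempty[OF topological_flow_reversed]
  by (simp add: alpha_limit_eq_omega_limit_reversed)

lemma connectedin_alpha_limit:
  "compact_space X \<Longrightarrow> x \<in> topspace X \<Longrightarrow> Hausdorff_space X \<Longrightarrow> connectedin X (alpha_limit X v x)"
  using topological_flow.connectedin_omega_limit[OF topological_flow_reversed]
  by (simp add: alpha_limit_eq_omega_limit_reversed)

section \<open>Closed orbits and the recurrence strata\<close>

lemma flow_of_int_period:
  assumes x: "x \<in> topspace X" and T: "v T x = x"
  shows "v (of_int k * T) x = x"
proof -
  have nat: "v (real n * T) x = x" for n
  proof (induction n)
    case 0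
    then show ?case by (simp add: flow_zero x)
  next
    case (Suc n)
    then show ?case using flow_add[OF x, of "real n * T" T] T by (simp add: algebra_simps)
  qed
  show ?thesis
  proof (cases k)
    case (nonneg n)
    then show ?thesis using nat by simp
  next
    case (neg n)
    have "of_int k * T = - (real (Suc n) * T)"
      unfolding neg by (simp add: algebra_simps)
    then show ?thesis
      using nat[of "Suc n"] flow_minus[OF x, of "real (Suc n) * T"] by metis
  qed
qed

lemma in_omega_limit_if_period:
  assumes x: "x \<in> topspace X" and T: "T > 0" "v T x = x"
  shows "x \<in> omega_limit X v x"
proof -
  have "x \<in> X closure_of {v t x |t. t > a}" for a
  proof -
    obtain n :: nat where "a < real n * T" using reals_Archimedean3[OF T(1)] by blast
    then have "x \<in> {v t x |t. t > a}"
      using flow_of_int_period[OF x T(2), of "int n"] by (intro CollectI exI[of _ "real n * T"]) simp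
    then show ?thesis
      using closure_of_subset[of "{v t x |t. t > a}" X] flow_in_topspace[OF x] by blast
  qed
  then show ?thesis unfolding omega_limit_def by blast
qed

lemma closedin_orbit_if_period:
  assumes "Hausdorff_space X" and x: "x \<in> topspace X" and T: "T > 0" "v T x = x"
  shows "closedin X (flow_orbit v x)"
proof -
  have "v t x \<in> (\<lambda>t. v t x) ` {0..T}" for t
  proof
    \<comment> \<open>Reducing \<open>t\<close> modulo \<open>T\<close> shows that the whole orbit
      is the image of the compact interval from 0 to \<open>T\<close>.\<close>
    show "t - of_int \<lfloor>t / T\<rfloor> * T \<in> {0..T}"
      using T(1) floor_divide_lower[OF T(1), of t] floor_divide_upper[OF T(1), of t]
      by (simp add: algebra_simps)
    show "v t x = v (t - of_int \<lfloor>t / T\<rfloor> * T) x"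
      using flow_add[OF x, of "t - of_int \<lfloor>t / T\<rfloor> * T" "of_int \<lfloor>t / T\<rfloor> * T"]
        flow_of_int_period[OF x T(2)] by simp
  qed
  then have "flow_orbit v x = (\<lambda>t. v t x) ` {0..T}" by (auto simp: flow_orbit_def)
  moreover have "compactin X ((\<lambda>t. v t x) ` {0..T})"
    by (rule image_compactin[OF _ continuous_map_flow_orbit[OF x]]) simp
  ultimately show ?thesis using assms(1) by (simp add: compactin_imp_closedin)
qed

text \<open>A singular point receives the period 1, so singular and periodic points can be treated
  alike; the period obtained may fail to be minimal.\<close>

lemma closed_orbit_points_period:
  assumes "x \<in> closed_orbit_points X v"
  obtains T where "T > 0" "v T x = x"
  using assms zero_less_one unfolding closed_orbit_points_def singular_points_def periodic_points_def by blast

lemma closed_orbit_points_subset_topspace: "closed_orbit_points X v \<subseteq> topspace X"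
  by (auto simp: closed_orbit_points_def singular_points_def periodic_points_def)

lemma closed_orbit_points_subset_recurrent: "closed_orbit_points X v \<subseteq> recurrent_points X v"
proof
  fix x assume x: "x \<in> closed_orbit_points X v"
  then have "x \<in> topspace X" using closed_orbit_points_subset_topspace by blast
  moreover obtain T where "T > 0" "v T x = x" using x by (rule closed_orbit_points_period)
  ultimately show "x \<in> recurrent_points X v"
    using in_omega_limit_if_period by (auto simp: recurrent_points_def)
qed

lemma disjnt_singular_periodic: "disjnt (singular_points X v) (periodic_points X v)"
proof -
  have False if "x \<in> singular_points X v" "x \<in> periodic_points X v" for x
  proof -
    obtain T where T: "T > 0" "\<And>t. 0 < t \<Longrightarrow> t < T \<Longrightarrow> v t x \<noteq> x"
      using \<open>x \<in> periodic_points X v\<close> by (auto simp: periodic_points_def)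
    then have "v (T / 2) x \<noteq> x" by simp
    then show False using that by (simp add: singular_points_def)
  qed
  then show ?thesis by (auto simp: disjnt_iff)
qed

lemma flow_in_singular_points: "x \<in> singular_points X v \<Longrightarrow> v t x \<in> singular_points X v"
  by (simp add: singular_points_def)

lemma flow_in_periodic_points:
  assumes "x \<in> periodic_points X v"
  shows "v t x \<in> periodic_points X v"
proof -
  obtain T where x: "x \<in> topspace X" and T: "T > 0" "v T x = x" "\<And>s. 0 < s \<Longrightarrow> s < T \<Longrightarrow> v s x \<noteq> x"
    using assms by (auto simp: periodic_points_def)
  have "v s x = x" if "v s (v t x) = v t x" for s
  proof -
    have "v s x = v (- t) (v t (v s x))" by (simp add: flow_minus flow_in_topspace x)
    also have "\<dots> = v (- t) (v t x)" using that by (simp add: flow_commute[OF x, of t s])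
    finally show ?thesis by (simp add: flow_minus x)
  qed
  moreover have "v T (v t x) = v t x" using T(2) by (simp add: flow_commute[OF x, of T t])
  ultimately show ?thesis using T(1,3) flow_in_topspace[OF x] unfolding periodic_points_def by blast
qed

lemma flow_in_recurrent_points:
  assumes "x \<in> recurrent_points X v"
  shows "v t x \<in> recurrent_points X v"
  using assms by (auto simp: recurrent_points_def alpha_limit_flow omega_limit_flow flow_in_topspace
      intro: flow_in_alpha_limit flow_in_omega_limit)

lemma flow_in_closed_orbit_points: "x \<in> closed_orbit_points X v \<Longrightarrow> v t x \<in> closed_orbit_points X v"
  using flow_in_singular_points flow_in_periodic_points by (auto simp: closed_orbit_points_def)

lemma in_closed_orbit_points_if_in_orbit:
  "x \<in> closed_orbit_points X v \<Longrightarrow> y \<in> flow_orbit v x \<Longrightarrow> y \<in> closed_orbit_points X v"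
  by (auto simp: flow_orbit_def flow_in_closed_orbit_points)

lemma flow_in_nonrecurrent_points:
  assumes "x \<in> nonrecurrent_points X v"
  shows "v t x \<in> nonrecurrent_points X v"
proof -
  have x: "x \<in> topspace X" "x \<notin> recurrent_points X v" using assms by (auto simp: nonrecurrent_points_def)
  have "v t x \<notin> recurrent_points X v"
    using flow_in_recurrent_points[of "v t x" "- t"] x by (auto simp: flow_minus)
  then show ?thesis using x by (simp add: nonrecurrent_points_def flow_in_topspace)
qed

text \<open>Disjointness makes the nested conditional in \<open>recurrence_stratum\<close>
  independent of the order of its tests: it then yields the one stratum containing the point, hence
  the same set for all points of that stratum.\<close>

lemma recurrence_strata_disjoint:
  shows "x \<in> singular_points X v \<Longrightarrow> x \<notin> periodic_points X v"
    and "x \<in> singular_points X v \<Longrightarrow> x \<notin> nonrecurrent_points X v"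
    and "x \<in> periodic_points X v \<Longrightarrow> x \<notin> nonrecurrent_points X v"
    and "x \<in> nonclosed_recurrent_points X v \<Longrightarrow>
      x \<notin> singular_points X v \<and> x \<notin> periodic_points X v \<and> x \<notin> nonrecurrent_points X v"
  using disjnt_singular_periodic closed_orbit_points_subset_recurrent
  by (auto simp: disjnt_iff closed_orbit_points_def nonrecurrent_points_def nonclosed_recurrent_points_def)

lemma in_recurrence_stratum: "x \<in> topspace X \<Longrightarrow> x \<in> recurrence_stratum X v x"
  by (auto simp: recurrence_stratum_def closed_orbit_points_def nonrecurrent_points_def
      nonclosed_recurrent_points_def)

lemma recurrence_stratum_eq:
  assumes "y \<in> recurrence_stratum X v x"
  shows "recurrence_stratum X v y = recurrence_stratum X v x"
  using assms recurrence_strata_disjoint[of y] by (auto simp: recurrence_stratum_def split: if_splits)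

lemma in_nonclosed_recurrent_points_iff_if_same_stratum:
  assumes "x \<in> topspace X" "y \<in> recurrence_stratum X v x"
  shows "y \<in> nonclosed_recurrent_points X v \<longleftrightarrow> x \<in> nonclosed_recurrent_points X v"
  using assms recurrence_strata_disjoint[of y] recurrence_strata_disjoint[of x] in_recurrence_stratum[OF assms(1)]
  by (auto simp: recurrence_stratum_def split: if_splits)

section \<open>The three decompositions into classes\<close>

lemma weak_orbit_class_eq: "y \<in> weak_orbit_class X v x \<Longrightarrow> weak_orbit_class X v y = weak_orbit_class X v x"
  by (simp add: weak_orbit_class_def)

lemma weak_orbit_class_subset_orbit_class: "weak_orbit_class X v x \<subseteq> orbit_class X v x"
  by (auto simp: weak_orbit_class_def orbit_class_def)

lemma partition_on_orbit_classes: "partition_on (topspace X) (orbit_classes X v)"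
  unfolding orbit_classes_def by (rule partition_on_classes) (auto simp: orbit_class_def)

lemma partition_on_weak_orbit_classes: "partition_on (topspace X) (weak_orbit_classes X v)"
  unfolding weak_orbit_classes_def by (rule partition_on_classes) (auto simp: weak_orbit_class_def)

text \<open>\<open>abstract_weak_orbit\<close> changes its definition at R(v), so classes could
  overlap unless a weak orbit class starting in R(v) stays there. Recurrence passes to
  \<open>y\<close> because a recurrent \<open>x\<close> has its whole orbit closure inside its limit
  sets, and \<open>y\<close> shares all three sets. Were the orbit of \<open>y\<close> closed, it
  would equal the common orbit closure and contain \<open>x\<close>.\<close>

lemma weak_orbit_class_nonclosed_recurrent:
  assumes "Hausdorff_space X" and x: "x \<in> nonclosed_recurrent_points X v"
    and y: "y \<in> weak_orbit_class X v x"
  shows "y \<in> nonclosed_recurrent_points X v"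
proof -
  have X: "x \<in> topspace X" "y \<in> topspace X"
    using x y by (auto simp: nonclosed_recurrent_points_def recurrent_points_def weak_orbit_class_def)
  have eqs: "X closure_of flow_orbit v y = X closure_of flow_orbit v x"
    "alpha_limit X v y = alpha_limit X v x" "omega_limit X v y = omega_limit X v x"
    using y by (auto simp: weak_orbit_class_def)
  have self: "z \<in> X closure_of flow_orbit v z" if "z \<in> topspace X" for z
    using closure_of_subset[OF flow_orbit_subset_topspace[OF that]] in_flow_orbit[OF that] by blast
  have "x \<in> alpha_limit X v x \<or> x \<in> omega_limit X v x"
    using x by (auto simp: nonclosed_recurrent_points_def recurrent_points_def)
  then have "X closure_of flow_orbit v x \<subseteq> alpha_limit X v x \<union> omega_limit X v x"
    using orbit_closure_subset_alpha_limit[OF X(1)] orbit_closure_subset_omega_limit[OF X(1)] by blast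
  then have "y \<in> recurrent_points X v"
    using self[OF X(2)] X(2) eqs by (auto simp: recurrent_points_def)
  moreover have "y \<notin> closed_orbit_points X v"
  proof
    assume cl: "y \<in> closed_orbit_points X v"
    then obtain T where "T > 0" "v T y = y" by (rule closed_orbit_points_period)
    then have "closedin X (flow_orbit v y)" using closedin_orbit_if_period[OF assms(1) X(2)] by blast
    then have "x \<in> flow_orbit v y" using self[OF X(1)] eqs(1) closure_of_closedin by metis
    then have "x \<in> closed_orbit_points X v" using cl in_closed_orbit_points_if_in_orbit by blast
    then show False using x by (simp add: nonclosed_recurrent_points_def)
  qed
  ultimately show ?thesis by (simp add: nonclosed_recurrent_points_def)
qed

lemma limit_component_subset:
  "limit_component X v x \<subseteq> {y \<in> topspace X. alpha_limit' X v y = alpha_limit' X v x \<and>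
     omega_limit' X v y = omega_limit' X v x}"
  unfolding limit_component_def
  by (rule order_trans[OF connected_component_of_subset_topspace]) simp

text \<open>The subspace in which the component is taken varies with the base point, but only
  through the primed limit sets. These agree at \<open>x\<close> and \<open>y\<close>, so both
  components live in one subspace.\<close>

lemma limit_component_eq:
  assumes "y \<in> limit_component X v x"
  shows "limit_component X v y = limit_component X v x"
proof -
  have eqs: "alpha_limit' X v y = alpha_limit' X v x" "omega_limit' X v y = omega_limit' X v x"
    using assms limit_component_subset by blast+
  show ?thesis
    using connected_component_of_set_eq[OF assms[unfolded limit_component_def]]
    unfolding limit_component_def eqs .
qed

lemma limit_stratum_component_subset:
  "limit_stratum_component X v x \<subseteq> limit_component X v x \<inter> recurrence_stratum X v x"
  unfolding limit_stratum_component_def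
  by (rule order_trans[OF connected_component_of_subset_topspace]) auto

lemma limit_stratum_component_eq:
  assumes "y \<in> limit_stratum_component X v x"
  shows "limit_stratum_component X v y = limit_stratum_component X v x"
proof -
  have eqs: "limit_component X v y = limit_component X v x"
    "recurrence_stratum X v y = recurrence_stratum X v x"
    using assms limit_stratum_component_subset limit_component_eq recurrence_stratum_eq by blast+
  show ?thesis
    using connected_component_of_set_eq[OF assms[unfolded limit_stratum_component_def]]
    unfolding limit_stratum_component_def eqs .
qed

lemma connectedin_limit_stratum_component: "connectedin X (limit_stratum_component X v x)"
  using connectedin_connected_component_of unfolding limit_stratum_component_def
  by (metis connectedin_subtopology)

text \<open>An orbit is connected, and both the primed limit sets and the stratum are constant along
  it. Consequently the part of a limit set that the primed versions discard stays inside the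
  class.\<close>

lemma flow_orbit_subset_limit_stratum_component:
  assumes x: "x \<in> topspace X"
  shows "flow_orbit v x \<subseteq> limit_stratum_component X v x"
proof -
  have con: "connectedin X (flow_orbit v x)" by (rule connectedin_flow_orbit[OF x])
  have orb: "flow_orbit v (v t x) = flow_orbit v x" for t
    by (rule flow_orbit_eq[OF x]) (simp add: flow_orbit_def)
  have "alpha_limit' X v (v t x) = alpha_limit' X v x" "omega_limit' X v (v t x) = omega_limit' X v x" for t
    by (simp_all add: alpha_limit'_def omega_limit'_def alpha_limit_flow[OF x] omega_limit_flow[OF x] orb)
  then have "flow_orbit v x \<subseteq> {y \<in> topspace X. alpha_limit' X v y = alpha_limit' X v x \<and>
     omega_limit' X v y = omega_limit' X v x}"
    using flow_in_topspace[OF x] by (auto simp: flow_orbit_def)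
  then have 1: "flow_orbit v x \<subseteq> limit_component X v x"
    unfolding limit_component_def
    by (intro connected_component_of_maximal in_flow_orbit x) (simp add: connectedin_subtopology con)
  have "flow_orbit v x \<subseteq> recurrence_stratum X v x"
  proof
    fix y assume "y \<in> flow_orbit v x"
    then obtain t where y: "y = v t x" by (rule flow_orbit_cases)
    \<comment> \<open>Orbits are symmetric: \<open>x\<close> lies in the orbit of \<open>y\<close>,
      so a closed orbit through \<open>y\<close> would also be one through \<open>x\<close>.\<close>
    have "y \<in> nonclosed_recurrent_points X v" if R: "x \<in> nonclosed_recurrent_points X v"
      using R in_closed_orbit_points_if_in_orbit[of y x] in_flow_orbit[OF x] orb[of t]
      by (auto simp: nonclosed_recurrent_points_def y flow_in_recurrent_points)
    then show "y \<in> recurrence_stratum X v x"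
      using in_recurrence_stratum[OF x] flow_in_singular_points[of x t] flow_in_periodic_points[of x t]
        flow_in_nonrecurrent_points[of x t] unfolding y recurrence_stratum_def by auto
  qed
  with 1 show ?thesis
    unfolding limit_stratum_component_def
    by (intro connected_component_of_maximal in_flow_orbit x) (simp add: connectedin_subtopology con)
qed

lemma in_limit_stratum_component: "x \<in> topspace X \<Longrightarrow> x \<in> limit_stratum_component X v x"
  using flow_orbit_subset_limit_stratum_component in_flow_orbit by blast

lemma abstract_weak_orbit_eq:
  assumes "Hausdorff_space X" and x: "x \<in> topspace X" and y: "y \<in> abstract_weak_orbit X v x"
  shows "abstract_weak_orbit X v y = abstract_weak_orbit X v x"
proof (cases "x \<in> nonclosed_recurrent_points X v")
  case True
  then show ?thesis
    using y weak_orbit_class_nonclosed_recurrent[OF assms(1), of x y] weak_orbit_class_eq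
    by (simp add: abstract_weak_orbit_def)
next
  case False
  then have y': "y \<in> limit_stratum_component X v x" using y by (simp add: abstract_weak_orbit_def)
  then have "y \<notin> nonclosed_recurrent_points X v"
    using in_nonclosed_recurrent_points_iff_if_same_stratum[OF x] limit_stratum_component_subset False
    by blast
  then show ?thesis using False limit_stratum_component_eq[OF y'] by (simp add: abstract_weak_orbit_def)
qed

lemma abstract_weak_orbit_subset_topspace: "abstract_weak_orbit X v x \<subseteq> topspace X"
proof -
  have "limit_stratum_component X v x \<subseteq> topspace X"
    using limit_stratum_component_subset limit_component_subset by blast
  then show ?thesis by (auto simp: abstract_weak_orbit_def weak_orbit_class_def)
qed

lemma partition_on_abstract_weak_orbits:
  assumes "Hausdorff_space X"
  shows "partition_on (topspace X) (abstract_weak_orbits X v)"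
  unfolding abstract_weak_orbits_def
proof (rule partition_on_classes)
  show "x \<in> abstract_weak_orbit X v x" if "x \<in> topspace X" for x
    using in_limit_stratum_component[OF that] that by (simp add: abstract_weak_orbit_def weak_orbit_class_def)
qed (use abstract_weak_orbit_eq[OF assms] abstract_weak_orbit_subset_topspace in auto)

section \<open>The pre-orders given by limit sets\<close>

text \<open>In a composition, the point \<open>b\<close> whose limit set meets \<open>A\<close> may
  differ from the point \<open>b'\<close> that lies in the limit set of \<open>c\<close>. The
  hypothesis \<open>cls\<close> bridges them: the meeting point is outside \<open>B\<close>, since
  distinct cells are disjoint, so it lies in the orbit closure of \<open>b'\<close>, which the limit
  set of \<open>c\<close> contains. The summand \<open>B\<close> in \<open>cls\<close> makes room
  for [x]'', whose members share limit sets only up to their own orbits.\<close>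

lemma preorder_on_limit_relation:
  assumes P: "partition_on (topspace X) P"
    and L: "\<And>c b. c \<in> topspace X \<Longrightarrow> b \<in> L c \<Longrightarrow> X closure_of flow_orbit v b \<subseteq> L c"
    and cls: "\<And>B b b'. B \<in> P \<Longrightarrow> b \<in> B \<Longrightarrow> b' \<in> B \<Longrightarrow> L b \<subseteq> B \<union> X closure_of flow_orbit v b'"
  shows "preorder_on P {(A, B) \<in> P \<times> P. A = B \<or> (\<exists>a\<in>A. \<exists>b\<in>B. a \<in> L b)}"
  unfolding preorder_on_def
proof (intro conjI)
  show "trans {(A, B) \<in> P \<times> P. A = B \<or> (\<exists>a\<in>A. \<exists>b\<in>B. a \<in> L b)}" (is "trans ?R")
  proof (rule transI)
    fix A B C
    assume AB: "(A, B) \<in> ?R" and BC: "(B, C) \<in> ?R"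
    show "(A, C) \<in> ?R"
    proof (cases "A = B \<or> B = C")
      case True
      then show ?thesis using AB BC by blast
    next
      case False
      then obtain a b b' c where abc: "a \<in> A" "b \<in> B" "a \<in> L b" "b' \<in> B" "c \<in> C" "b' \<in> L c"
        and P': "A \<in> P" "B \<in> P" "C \<in> P"
        using AB BC by blast
      have "a \<notin> B"
        using disjointD[OF partition_onD2[OF P] P'(1,2)] False abc(1) by blast
      then have "a \<in> X closure_of flow_orbit v b'" using cls[OF P'(2) abc(2,4)] abc(3) by blast
      moreover have "c \<in> topspace X" using partition_onD1[OF P] abc P' by blast
      ultimately have "a \<in> L c" using L abc(6) by blast
      then show ?thesis using abc P' by blast
    qed
  qed
qed (auto simp: refl_on_def)

lemma
  assumes "P \<in> {orbit_classes X v, weak_orbit_classes X v}" "B \<in> P" "b \<in> B" "b' \<in> B"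
  shows alpha_limit_subset_class: "alpha_limit X v b \<subseteq> X closure_of flow_orbit v b'"
    and omega_limit_subset_class: "omega_limit X v b \<subseteq> X closure_of flow_orbit v b'"
proof -
  have "X closure_of flow_orbit v b = X closure_of flow_orbit v b'"
    using assms by (auto simp: orbit_classes_def weak_orbit_classes_def orbit_class_def weak_orbit_class_def)
  then show "alpha_limit X v b \<subseteq> X closure_of flow_orbit v b'"
    "omega_limit X v b \<subseteq> X closure_of flow_orbit v b'"
    using alpha_limit_subset_orbit_closure omega_limit_subset_orbit_closure by blast+
qed

text \<open>In a component [x]'', the limit set of \<open>b\<close> splits into a part in the orbit
  of \<open>b\<close>, which the class contains, and a rest that is also part of the limit set of
  \<open>b'\<close>. In a class of R(v) all orbit closures coincide.\<close>

lemma
  assumes haus: "Hausdorff_space X" and B: "B \<in> abstract_weak_orbits X v" "b \<in> B" "b' \<in> B"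
  shows alpha_limit_subset_abstract_weak_orbit:
      "alpha_limit X v b \<subseteq> B \<union> X closure_of flow_orbit v b'"
    and omega_limit_subset_abstract_weak_orbit:
      "omega_limit X v b \<subseteq> B \<union> X closure_of flow_orbit v b'"
proof -
  have b: "b \<in> topspace X" "b' \<in> topspace X" "B = abstract_weak_orbit X v b"
    using B abstract_weak_orbit_subset_topspace abstract_weak_orbit_eq[OF haus]
    unfolding abstract_weak_orbits_def by blast+
  have "L b \<subseteq> B \<union> X closure_of flow_orbit v b'"
    if closure: "\<And>z. L z \<subseteq> X closure_of flow_orbit v z"
      and eq: "B = limit_stratum_component X v b \<Longrightarrow> L b - flow_orbit v b = L b' - flow_orbit v b'" for L
  proof (cases "b \<in> nonclosed_recurrent_points X v")
    case True
    then have "X closure_of flow_orbit v b' = X closure_of flow_orbit v b"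
      using B(3) b(3) by (simp add: abstract_weak_orbit_def weak_orbit_class_def)
    then show ?thesis using closure by blast
  next
    case False
    then have B': "B = limit_stratum_component X v b" using b(3) by (simp add: abstract_weak_orbit_def)
    have "L b \<subseteq> flow_orbit v b \<union> (L b' - flow_orbit v b')" using eq[OF B'] by blast
    then show ?thesis
      using flow_orbit_subset_limit_stratum_component[OF b(1)] closure[of b'] unfolding B' by blast
  qed
  note * = this
  have eq: "alpha_limit' X v b = alpha_limit' X v b' \<and> omega_limit' X v b = omega_limit' X v b'"
    if "B = limit_stratum_component X v b"
    using B(3) limit_stratum_component_subset[of b] limit_component_subset[of b] that by auto
  show "alpha_limit X v b \<subseteq> B \<union> X closure_of flow_orbit v b'"
    using alpha_limit_subset_orbit_closure eq by (intro *) (auto simp: alpha_limit'_def)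
  show "omega_limit X v b \<subseteq> B \<union> X closure_of flow_orbit v b'"
    using omega_limit_subset_orbit_closure eq by (intro *) (auto simp: omega_limit'_def)
qed

lemma
  assumes "Hausdorff_space X"
    and P: "P \<in> {abstract_weak_orbits X v, weak_orbit_classes X v, orbit_classes X v}"
  shows partition_on_flow_classes: "partition_on (topspace X) P"
    and preorder_on_le_alpha: "preorder_on P (le_alpha X v P)"
    and preorder_on_le_omega: "preorder_on P (le_omega X v P)"
proof -
  show P': "partition_on (topspace X) P"
    using P partition_on_orbit_classes partition_on_weak_orbit_classes
      partition_on_abstract_weak_orbits[OF assms(1)] by blast
  show "preorder_on P (le_alpha X v P)"
    unfolding le_alpha_def
  proof (rule preorder_on_limit_relation[OF P' orbit_closure_subset_alpha_limit])
    show "alpha_limit X v b \<subseteq> B \<union> X closure_of flow_orbit v b'" if "B \<in> P" "b \<in> B" "b' \<in> B" for B b b'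
      using P that alpha_limit_subset_class[of P B b b'] alpha_limit_subset_abstract_weak_orbit[OF assms(1), of B b b']
      by blast
  qed
  show "preorder_on P (le_omega X v P)"
    unfolding le_omega_def
  proof (rule preorder_on_limit_relation[OF P' orbit_closure_subset_omega_limit])
    show "omega_limit X v b \<subseteq> B \<union> X closure_of flow_orbit v b'" if "B \<in> P" "b \<in> B" "b' \<in> B" for B b b'
      using P that omega_limit_subset_class[of P B b b'] omega_limit_subset_abstract_weak_orbit[OF assms(1), of B b b']
      by blast
  qed
qed

end

section \<open>Chain recurrence\<close>

locale metric_flow = Metric_space M d + topological_flow "Metric_space.mtopology M d" v
  for M :: "'a set" and d and v
begin

text \<open>With a one-step relation, chains become its transitive closure, and cutting or joining
  them is relational algebra. The closure is not the reflexive one, as a chain has at least one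
  step.\<close>

definition chain_step :: "real \<Rightarrow> real \<Rightarrow> 'a \<Rightarrow> 'a \<Rightarrow> bool" where
  "chain_step \<epsilon> T x y \<longleftrightarrow> x \<in> M \<and> y \<in> M \<and> (\<exists>t>T. d (v t x) y < \<epsilon>)"

definition chain_reach :: "'a \<Rightarrow> 'a \<Rightarrow> bool" where
  "chain_reach x y \<longleftrightarrow> (\<forall>\<epsilon>>0. \<forall>T>0. (chain_step \<epsilon> T)\<^sup>+\<^sup>+ x y)"

abbreviation chain_recurrent :: "'a set" where
  "chain_recurrent \<equiv> chain_recurrent_points M d v"

lemma flow_in: "x \<in> M \<Longrightarrow> v t x \<in> M"
  using flow_in_topspace by simp

lemma eps_chain_iff_tranclp_chain_step:
  "eps_chain M d v \<epsilon> T x y \<longleftrightarrow> (chain_step \<epsilon> T)\<^sup>+\<^sup>+ x y"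
proof
  assume "eps_chain M d v \<epsilon> T x y"
  then obtain k p t where p: "p 0 = x" "p (Suc k) = y" "\<And>i. i \<le> Suc k \<Longrightarrow> p i \<in> M"
    "\<And>i. i \<le> k \<Longrightarrow> t i > T \<and> d (v (t i) (p i)) (p (Suc i)) < \<epsilon>"
    unfolding eps_chain_def by blast
  have step: "chain_step \<epsilon> T (p i) (p (Suc i))" if "i \<le> k" for i
    using p(3,4) that unfolding chain_step_def by auto
  have "(chain_step \<epsilon> T)\<^sup>+\<^sup>+ (p 0) (p (Suc j))" if "j \<le> k" for j
    using that by (induction j) (auto intro: step tranclp.intros)
  then show "(chain_step \<epsilon> T)\<^sup>+\<^sup>+ x y" using p by blast
next
  assume "(chain_step \<epsilon> T)\<^sup>+\<^sup>+ x y"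
  then show "eps_chain M d v \<epsilon> T x y"
  proof (induction rule: tranclp_induct)
    case (base y)
    then obtain t where t: "x \<in> M" "y \<in> M" "t > T" "d (v t x) y < \<epsilon>"
      unfolding chain_step_def by blast
    show ?case unfolding eps_chain_def
      by (rule exI[of _ 0], rule exI[of _ "\<lambda>i. if i = 0 then x else y"], rule exI[of _ "\<lambda>_. t"])
        (use t in auto)
  next
    case (step y z)
    then obtain s where s: "z \<in> M" "s > T" "d (v s y) z < \<epsilon>"
      unfolding chain_step_def by blast
    obtain k p t where p: "p 0 = x" "p (Suc k) = y" "\<forall>i\<le>Suc k. p i \<in> M"
      "\<forall>i\<le>k. t i > T \<and> d (v (t i) (p i)) (p (Suc i)) < \<epsilon>"
      using step.IH unfolding eps_chain_def by blast
    \<comment> \<open>The old chain uses points 0 to \<open>Suc k\<close> and times 0 to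
      \<open>k\<close>, so the new time \<open>s\<close> gets index \<open>Suc k\<close> and the new
      endpoint index \<open>Suc (Suc k)\<close>.\<close>
    show ?case unfolding eps_chain_def
      by (rule exI[of _ "Suc k"], rule exI[of _ "\<lambda>i. if i \<le> Suc k then p i else z"],
          rule exI[of _ "\<lambda>i. if i \<le> k then t i else s"])
        (use s p in \<open>auto simp: le_Suc_eq\<close>)
  qed
qed

lemma chain_recurrent_iff: "x \<in> chain_recurrent \<longleftrightarrow> x \<in> M \<and> chain_reach x x"
  by (simp add: chain_recurrent_points_def chain_reach_def eps_chain_iff_tranclp_chain_step)

lemma chain_recurrent_subset: "chain_recurrent \<subseteq> M"
  by (auto simp: chain_recurrent_points_def)

lemma chain_reach_trans: "chain_reach x y \<Longrightarrow> chain_reach y z \<Longrightarrow> chain_reach x z"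
  unfolding chain_reach_def by (meson tranclp_trans)

lemma chain_step_mono:
  "chain_step \<epsilon>' T' x y \<Longrightarrow> \<epsilon>' \<le> \<epsilon> \<Longrightarrow> T \<le> T' \<Longrightarrow> chain_step \<epsilon> T x y"
  unfolding chain_step_def by (meson le_less_trans less_le_trans)

lemma rtranclp_chain_step_mono:
  "(chain_step \<epsilon>' T')\<^sup>*\<^sup>* x y \<Longrightarrow> \<epsilon>' \<le> \<epsilon> \<Longrightarrow> T \<le> T' \<Longrightarrow> (chain_step \<epsilon> T)\<^sup>*\<^sup>* x y"
  by (erule rtranclp_mono[THEN predicate2D, rotated]) (auto intro: chain_step_mono)

lemma tranclp_chain_step_mono:
  "(chain_step \<epsilon>' T')\<^sup>+\<^sup>+ x y \<Longrightarrow> \<epsilon>' \<le> \<epsilon> \<Longrightarrow> T \<le> T' \<Longrightarrow> (chain_step \<epsilon> T)\<^sup>+\<^sup>+ x y"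
  by (induction rule: tranclp_induct) (auto intro: chain_step_mono tranclp.intros)

lemma tranclp_last_step:
  assumes "r\<^sup>+\<^sup>+ x y"
  obtains z where "r\<^sup>*\<^sup>* x z" "r z y"
  using assms by (metis tranclp.cases tranclp_into_rtranclp rtranclp.rtrancl_refl)

text \<open>The radius depends on \<open>t\<close>. It is therefore only used with times fixed
  beforehand: \<open>T + 1\<close>, a given shift, or a step of a chain already chosen.\<close>

lemma flow_close:
  assumes "x \<in> M" "\<epsilon> > 0"
  obtains \<delta> where "\<delta> > 0" "\<And>y. y \<in> M \<Longrightarrow> d x y < \<delta> \<Longrightarrow> d (v t x) (v t y) < \<epsilon>"
proof -
  let ?U = "{y \<in> topspace mtopology. v t y \<in> mball (v t x) \<epsilon>}"
  have "openin mtopology ?U"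
    by (rule openin_continuous_map_preimage[OF continuous_map_flow_time openin_mball])
  moreover have "x \<in> ?U" using assms flow_in by simp
  ultimately obtain \<delta> where "\<delta> > 0" "mball x \<delta> \<subseteq> ?U" unfolding openin_mtopology by blast
  moreover from this have "d (v t x) (v t y) < \<epsilon>" if "y \<in> M" "d x y < \<delta>" for y
    using that assms(1) in_mball[of y x \<delta>] by auto
  ultimately show ?thesis using that by blast
qed

lemma closure_of_close:
  assumes "x \<in> mtopology closure_of A" "\<epsilon> > 0"
  obtains y where "y \<in> A" "y \<in> M" "d x y < \<epsilon>"
  using assms unfolding metric_closure_of by auto

text \<open>Splitting a long first step at time \<open>T + 1\<close> lets the starting point move by an amount that
  does not depend on the length of that step.\<close>

lemma tranclp_chain_step_move_start:
  assumes chain: "(chain_step \<epsilon> (2 * T + 2))\<^sup>+\<^sup>+ x y" and T: "T > 0" and z: "z \<in> M"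
    and close: "d (v (T + 1) z) (v (T + 1) x) < \<epsilon>"
  shows "(chain_step \<epsilon> T)\<^sup>+\<^sup>+ z y"
proof -
  obtain p where p: "chain_step \<epsilon> (2 * T + 2) x p" "(chain_step \<epsilon> (2 * T + 2))\<^sup>*\<^sup>* p y"
    using tranclpD[OF chain] by blast
  obtain t where t: "t > 2 * T + 2" "d (v t x) p < \<epsilon>" and M: "x \<in> M" "p \<in> M"
    using p(1) unfolding chain_step_def by blast
  have "chain_step \<epsilon> T z (v (T + 1) x)"
    using z close M flow_in unfolding chain_step_def by (auto intro!: exI[of _ "T + 1"])
  moreover have "chain_step \<epsilon> T (v (T + 1) x) p"
    using t M flow_in flow_add[of x "t - (T + 1)" "T + 1"] T
    unfolding chain_step_def by (auto intro!: exI[of _ "t - (T + 1)"])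
  moreover have "(chain_step \<epsilon> T)\<^sup>*\<^sup>* p y" using p(2) T by (auto intro: rtranclp_chain_step_mono)
  ultimately show ?thesis by (meson rtranclp_into_tranclp2 converse_rtranclp_into_rtranclp)
qed

text \<open>Only the last jump changes, and by the triangle inequality its error grows by at most
  \<open>d y z\<close>.\<close>

lemma tranclp_chain_step_move_end:
  assumes "(chain_step \<epsilon>' T)\<^sup>+\<^sup>+ x y" "z \<in> M" "\<epsilon>' + d y z \<le> \<epsilon>"
  shows "(chain_step \<epsilon> T)\<^sup>+\<^sup>+ x z"
proof -
  obtain p where p: "(chain_step \<epsilon>' T)\<^sup>*\<^sup>* x p" "chain_step \<epsilon>' T p y"
    using assms(1) by (rule tranclp_last_step)
  obtain t where t: "t > T" "d (v t p) y < \<epsilon>'" and M: "p \<in> M" "y \<in> M"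
    using p(2) unfolding chain_step_def by blast
  have "d (v t p) z < \<epsilon>"
    using triangle[of "v t p" y z] t assms M flow_in by force
  then have "chain_step \<epsilon> T p z" using t M assms(2) unfolding chain_step_def by blast
  moreover have "\<epsilon>' \<le> \<epsilon>" using assms(3) nonneg[of y z] by linarith
  then have "(chain_step \<epsilon> T)\<^sup>*\<^sup>* x p" using p(1) by (auto intro: rtranclp_chain_step_mono)
  ultimately show ?thesis by (rule rtranclp_into_tranclp1[rotated])
qed

section \<open>Chains to and from limit sets\<close>

lemma omega_limit_close:
  assumes "z \<in> omega_limit mtopology v x" "\<epsilon> > 0"
  obtains t where "t > a" "d z (v t x) < \<epsilon>"
proof -
  have "z \<in> mtopology closure_of {v t x |t. t > a}" using assms(1) by (auto simp: omega_limit_def)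
  then show ?thesis using that assms(2) by (elim closure_of_close) auto
qed

lemma alpha_limit_close:
  assumes "z \<in> alpha_limit mtopology v x" "\<epsilon> > 0"
  obtains t where "t < a" "d z (v t x) < \<epsilon>"
proof -
  have "z \<in> mtopology closure_of {v t x |t. t < a}" using assms(1) by (auto simp: alpha_limit_def)
  then show ?thesis using that assms(2) by (elim closure_of_close) auto
qed

lemma chain_reach_omega_limit:
  assumes "x \<in> M" "z \<in> omega_limit mtopology v x"
  shows "chain_reach x z"
  unfolding chain_reach_def
proof (intro allI impI)
  fix \<epsilon> T :: real assume "\<epsilon> > 0" "T > 0"
  then obtain t where "t > T" "d z (v t x) < \<epsilon>" using omega_limit_close assms by blast
  moreover have "z \<in> M" using assms(2) omega_limit_subset_topspace by auto
  ultimately have "chain_step \<epsilon> T x z" using assms(1) commute unfolding chain_step_def by metis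
  then show "(chain_step \<epsilon> T)\<^sup>+\<^sup>+ x z" by (rule tranclp.r_into_trancl)
qed

text \<open>Near \<open>z\<close> there is a point \<open>v t x\<close> with \<open>t\<close> very
  negative, and one exact step of duration \<open>- t\<close> leads from it to \<open>x\<close>.
  Moving the start of this step to \<open>z\<close> is the only source of error, and the step is cut
  for it.\<close>

lemma chain_reach_alpha_limit:
  assumes "x \<in> M" "z \<in> alpha_limit mtopology v x"
  shows "chain_reach z x"
  unfolding chain_reach_def
proof (intro allI impI)
  fix \<epsilon> T :: real assume *: "\<epsilon> > 0" "T > 0"
  have z: "z \<in> M" using assms(2) alpha_limit_subset_topspace by auto
  obtain \<delta> where \<delta>: "\<delta> > 0" "\<And>y. y \<in> M \<Longrightarrow> d z y < \<delta> \<Longrightarrow> d (v (T + 1) z) (v (T + 1) y) < \<epsilon>"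
    using flow_close[OF z *(1)] by metis
  obtain t where t: "t < - (2 * T + 2)" "d z (v t x) < \<delta>"
    using alpha_limit_close[OF assms(2) \<delta>(1)] by metis
  have "chain_step \<epsilon> (2 * T + 2) (v t x) x"
    using t(1) *(1) assms(1) flow_in flow_minus[of x t]
    unfolding chain_step_def by (auto intro!: exI[of _ "- t"])
  then show "(chain_step \<epsilon> T)\<^sup>+\<^sup>+ z x"
    using tranclp_chain_step_move_start[OF tranclp.r_into_trancl *(2) z] \<delta>(2) t(2) flow_in assms(1)
    by blast
qed

text \<open>One orbit passing \<open>z\<close> twice, with a long time in between, gives a single
  step from the first passage to the second. Its start is moved to \<open>z\<close> and its end
  jumps to \<open>z\<close>; the minimum of \<delta> and \<epsilon> serves the two ends. Both kinds
  of limit points satisfy the hypothesis.\<close>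

lemma chain_recurrent_if_returns:
  assumes "x \<in> M" "z \<in> M"
    and ret: "\<And>\<delta> L. \<delta> > 0 \<Longrightarrow> \<exists>a b. b > a + L \<and> d z (v a x) < \<delta> \<and> d z (v b x) < \<delta>"
  shows "z \<in> chain_recurrent"
  unfolding chain_recurrent_iff chain_reach_def
proof (intro conjI allI impI)
  fix \<epsilon> T :: real assume *: "\<epsilon> > 0" "T > 0"
  obtain \<delta> where \<delta>: "\<delta> > 0" "\<And>y. y \<in> M \<Longrightarrow> d z y < \<delta> \<Longrightarrow> d (v (T + 1) z) (v (T + 1) y) < \<epsilon>"
    using flow_close[OF assms(2) *(1)] by metis
  obtain a b where ab: "b > a + (2 * T + 2)" "d z (v a x) < min \<delta> \<epsilon>" "d z (v b x) < min \<delta> \<epsilon>"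
    using ret[of "min \<delta> \<epsilon>" "2 * T + 2"] \<delta>(1) *(1) by auto
  have "d (v (b - a) (v a x)) z < \<epsilon>"
    using ab(3) flow_add[of x "b - a" a] assms(1) commute by simp
  then have "chain_step \<epsilon> (2 * T + 2) (v a x) z"
    using ab(1) assms(1,2) flow_in unfolding chain_step_def by (auto intro!: exI[of _ "b - a"])
  then show "(chain_step \<epsilon> T)\<^sup>+\<^sup>+ z z"
    using tranclp_chain_step_move_start[OF tranclp.r_into_trancl *(2) assms(2)] \<delta>(2) ab(2) flow_in assms(1)
    by simp
qed (rule assms(2))

lemma omega_limit_subset_chain_recurrent:
  assumes "x \<in> M"
  shows "omega_limit mtopology v x \<subseteq> chain_recurrent"
proof
  fix z assume z: "z \<in> omega_limit mtopology v x"
  show "z \<in> chain_recurrent"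
  proof (rule chain_recurrent_if_returns[OF assms])
    show "z \<in> M" using z omega_limit_subset_topspace by auto
    fix \<delta> L :: real assume "\<delta> > 0"
    then obtain a where "d z (v a x) < \<delta>" using omega_limit_close[OF z, of \<delta> 0] by blast
    moreover obtain b where "b > a + L" "d z (v b x) < \<delta>"
      using omega_limit_close[OF z \<open>\<delta> > 0\<close>] by blast
    ultimately show "\<exists>a b. b > a + L \<and> d z (v a x) < \<delta> \<and> d z (v b x) < \<delta>" by blast
  qed
qed

lemma alpha_limit_subset_chain_recurrent:
  assumes "x \<in> M"
  shows "alpha_limit mtopology v x \<subseteq> chain_recurrent"
proof
  fix z assume z: "z \<in> alpha_limit mtopology v x"
  show "z \<in> chain_recurrent"
  proof (rule chain_recurrent_if_returns[OF assms])
    show "z \<in> M" using z alpha_limit_subset_topspace by auto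
    fix \<delta> L :: real assume "\<delta> > 0"
    then obtain b where "d z (v b x) < \<delta>" using alpha_limit_close[OF z, of \<delta> 0] by blast
    moreover obtain a where "a < b - L" "d z (v a x) < \<delta>"
      using alpha_limit_close[OF z \<open>\<delta> > 0\<close>] by blast
    moreover have "b > a + L" using \<open>a < b - L\<close> by simp
    ultimately show "\<exists>a b. b > a + L \<and> d z (v a x) < \<delta> \<and> d z (v b x) < \<delta>" by blast
  qed
qed

text \<open>A loop at a nearby chain recurrent \<open>x\<close> is used twice: with its start moved
  it leads from \<open>z\<close> to \<open>x\<close>, with its end moved from \<open>x\<close> to
  \<open>z\<close>. Halving \<epsilon> leaves room for the longer last jump. Closedness is what
  later makes the Morse sets closed in the whole space.\<close>

lemma closedin_chain_recurrent: "closedin mtopology chain_recurrent"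
proof -
  have "z \<in> chain_recurrent" if z: "z \<in> mtopology closure_of chain_recurrent" for z
    unfolding chain_recurrent_iff chain_reach_def
  proof (intro conjI allI impI)
    show zM: "z \<in> M" using z by (simp add: metric_closure_of)
    fix \<epsilon> T :: real assume *: "\<epsilon> > 0" "T > 0"
    obtain \<delta> where \<delta>: "\<delta> > 0" "\<And>y. y \<in> M \<Longrightarrow> d z y < \<delta> \<Longrightarrow> d (v (T + 1) z) (v (T + 1) y) < \<epsilon>"
      using flow_close[OF zM *(1)] by metis
    obtain x where x: "x \<in> chain_recurrent" "x \<in> M" "d z x < min \<delta> (\<epsilon> / 2)"
      using closure_of_close[OF z, of "min \<delta> (\<epsilon> / 2)"] \<delta>(1) *(1) by auto
    have chain: "(chain_step (\<epsilon> / 2) (2 * T + 2))\<^sup>+\<^sup>+ x x"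
      using x(1) * unfolding chain_recurrent_iff chain_reach_def by simp
    have "(chain_step \<epsilon> T)\<^sup>+\<^sup>+ z x"
    proof (rule tranclp_chain_step_move_start[OF _ *(2) zM])
      show "(chain_step \<epsilon> (2 * T + 2))\<^sup>+\<^sup>+ x x"
        using chain *(1) by (auto intro: tranclp_chain_step_mono)
      show "d (v (T + 1) z) (v (T + 1) x) < \<epsilon>" using x \<delta>(2) by simp
    qed
    moreover have "(chain_step \<epsilon> (2 * T + 2))\<^sup>+\<^sup>+ x z"
      using tranclp_chain_step_move_end[OF chain zM] x(3) commute by simp
    then have "(chain_step \<epsilon> T)\<^sup>+\<^sup>+ x z" using *(2) by (auto intro: tranclp_chain_step_mono)
    ultimately show "(chain_step \<epsilon> T)\<^sup>+\<^sup>+ z z" by (rule tranclp_trans)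
  qed
  then show ?thesis
    using closure_of_subset[of chain_recurrent mtopology] chain_recurrent_subset
    by (metis closure_of_eq subsetI subset_antisym topspace_mtopology)
qed

section \<open>Invariance of chain recurrence under the flow\<close>

lemma chain_reach_flow_right:
  assumes "y \<in> M" "chain_reach x y"
  shows "chain_reach x (v r y)"
  unfolding chain_reach_def
proof (intro allI impI)
  fix \<epsilon> T :: real assume *: "\<epsilon> > 0" "T > 0"
  obtain \<delta> where \<delta>: "\<delta> > 0" "\<And>z. z \<in> M \<Longrightarrow> d y z < \<delta> \<Longrightarrow> d (v r y) (v r z) < \<epsilon>"
    using flow_close[OF assms(1) *(1)] by metis
  \<comment> \<open>The last step will be prolonged by \<open>r\<close>: the surplus
    \<open>\<bar>r\<bar>\<close> keeps its duration above \<open>T\<close> when \<open>r\<close> is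
    negative, and the bound \<delta> controls its final jump after \<open>v r\<close> is applied.
    The bound \<epsilon> serves the other steps.\<close>
  have "(chain_step (min \<delta> \<epsilon>) (T + \<bar>r\<bar>))\<^sup>+\<^sup>+ x y"
    using assms(2) * \<delta>(1) unfolding chain_reach_def by simp
  then obtain p where p: "(chain_step (min \<delta> \<epsilon>) (T + \<bar>r\<bar>))\<^sup>*\<^sup>* x p" "chain_step (min \<delta> \<epsilon>) (T + \<bar>r\<bar>) p y"
    by (rule tranclp_last_step)
  obtain t where t: "t > T + \<bar>r\<bar>" "d (v t p) y < min \<delta> \<epsilon>" "p \<in> M"
    using p(2) unfolding chain_step_def by blast
  have "d (v (r + t) p) (v r y) < \<epsilon>"
    using \<delta>(2)[of "v t p"] t flow_in commute flow_add[of p r t] by simp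
  then have "chain_step \<epsilon> T p (v r y)"
    using t assms(1) flow_in unfolding chain_step_def by (auto intro!: exI[of _ "r + t"])
  moreover have "(chain_step \<epsilon> T)\<^sup>*\<^sup>* x p" using p(1) by (auto intro: rtranclp_chain_step_mono)
  ultimately show "(chain_step \<epsilon> T)\<^sup>+\<^sup>+ x (v r y)" by (rule rtranclp_into_tranclp1[rotated])
qed

lemma chain_reach_flow_left:
  assumes "x \<in> M" "chain_reach x y"
  shows "chain_reach (v r x) y"
  unfolding chain_reach_def
proof (intro allI impI)
  fix \<epsilon> T :: real assume *: "\<epsilon> > 0" "T > 0"
  have "(chain_step \<epsilon> (T + \<bar>r\<bar>))\<^sup>+\<^sup>+ x y"
    using assms(2) * unfolding chain_reach_def by simp
  then obtain p where p: "chain_step \<epsilon> (T + \<bar>r\<bar>) x p" "(chain_step \<epsilon> (T + \<bar>r\<bar>))\<^sup>*\<^sup>* p y"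
    by (meson tranclpD)
  obtain t where t: "t > T + \<bar>r\<bar>" "d (v t x) p < \<epsilon>" "p \<in> M"
    using p(1) unfolding chain_step_def by blast
  have "chain_step \<epsilon> T (v r x) p"
    using t assms(1) flow_in flow_add[of x "t - r" r] unfolding chain_step_def
    by (auto intro!: exI[of _ "t - r"])
  moreover have "(chain_step \<epsilon> T)\<^sup>*\<^sup>* p y" using p(2) by (auto intro: rtranclp_chain_step_mono)
  ultimately show "(chain_step \<epsilon> T)\<^sup>+\<^sup>+ (v r x) y" by (rule rtranclp_into_tranclp2)
qed

lemma flow_in_chain_recurrent: "x \<in> chain_recurrent \<Longrightarrow> v t x \<in> chain_recurrent"
  by (simp add: chain_recurrent_iff flow_in chain_reach_flow_left chain_reach_flow_right)

lemma flow_orbit_subset_chain_recurrent: "x \<in> chain_recurrent \<Longrightarrow> flow_orbit v x \<subseteq> chain_recurrent"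
  by (auto simp: flow_orbit_def flow_in_chain_recurrent)

lemma openin_subtopology_mball:
  assumes "\<And>z. z \<in> A \<Longrightarrow> \<exists>r>0. C \<inter> mball z r \<subseteq> A" "A \<subseteq> C" "C \<subseteq> M"
  shows "openin (subtopology mtopology C) A"
proof (subst openin_subopen, intro ballI)
  fix z assume z: "z \<in> A"
  then obtain r where r: "r > 0" "C \<inter> mball z r \<subseteq> A" using assms(1) by blast
  moreover have "z \<in> C \<inter> mball z r" using z assms r by auto
  ultimately show "\<exists>U. openin (subtopology mtopology C) U \<and> z \<in> U \<and> U \<subseteq> A"
    using openin_subtopology_Int2[OF openin_mball] by blast
qed

text \<open>For fixed \<open>\<epsilon>\<close> and \<open>T\<close>, the points of \<open>C\<close> that can be reached form a relatively clopen set.\<close>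

lemma chain_reach_connected:
  assumes con: "connectedin mtopology C" and C: "C \<subseteq> chain_recurrent" and xy: "x \<in> C" "y \<in> C"
  shows "chain_reach x y"
  unfolding chain_reach_def
proof (intro allI impI)
  fix \<epsilon> T :: real assume *: "\<epsilon> > 0" "T > 0"
  let ?R = "chain_step \<epsilon> T"
  define A where "A = {z \<in> C. ?R\<^sup>+\<^sup>+ x z}"
  have CM: "C \<subseteq> M" using C chain_recurrent_subset by blast
  have self: "?R\<^sup>+\<^sup>+ z z" if "z \<in> C" for z
    using that C * unfolding chain_recurrent_iff chain_reach_def subset_iff by blast
  have "openin (subtopology mtopology C) A"
  proof (rule openin_subtopology_mball)
    fix z assume z: "z \<in> A"
    then obtain p where p: "?R\<^sup>*\<^sup>* x p" "?R p z"
      unfolding A_def using tranclp_last_step[of ?R x z] by blast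
    then obtain t where t: "t > T" "d (v t p) z < \<epsilon>" "p \<in> M" "z \<in> M" unfolding chain_step_def by blast
    have "w \<in> A" if "w \<in> C" "d z w < \<epsilon> - d (v t p) z" for w
    proof -
      have "w \<in> M" using that CM by blast
      then have "?R p w"
        using triangle[of "v t p" z w] that t flow_in unfolding chain_step_def by force
      then show ?thesis using p(1) that(1) by (auto simp: A_def intro: rtranclp_into_tranclp1)
    qed
    then show "\<exists>r>0. C \<inter> mball z r \<subseteq> A"
      using t by (intro exI[of _ "\<epsilon> - d (v t p) z"]) auto
  qed (use CM in \<open>auto simp: A_def\<close>)
  moreover have "openin (subtopology mtopology C) (C - A)"
  proof (rule openin_subtopology_mball)
    fix z assume z: "z \<in> C - A"
    \<comment> \<open>A loop at \<open>z\<close> is fixed before the radius is chosen, so continuity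
      of the one map \<open>v t\<close> at \<open>z\<close> suffices: each nearby \<open>w\<close>
      can replace \<open>z\<close> as the start of the loop and thus reaches \<open>z\<close>. If
      \<open>w\<close> were in \<open>A\<close>, so would be \<open>z\<close>.\<close>
    then obtain p where p: "?R z p" "?R\<^sup>*\<^sup>* p z" using self tranclpD[of ?R z z] by blast
    then obtain t where t: "t > T" "d (v t z) p < \<epsilon>" "p \<in> M" "z \<in> M" unfolding chain_step_def by blast
    then obtain \<delta> where \<delta>: "\<delta> > 0" "\<And>w. w \<in> M \<Longrightarrow> d z w < \<delta> \<Longrightarrow> d (v t z) (v t w) < \<epsilon> - d (v t z) p"
      using flow_close[of z "\<epsilon> - d (v t z) p" t] by auto
    have False if w: "w \<in> A" "d z w < \<delta>" for w
    proof -
      have wM: "w \<in> M" using w CM by (auto simp: A_def)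
      have "d (v t w) p < \<epsilon>"
        using triangle[of "v t w" "v t z" p] \<delta>(2)[OF wM w(2)] t wM flow_in commute[of "v t w" "v t z"] by force
      then have "?R w p" using t wM unfolding chain_step_def by blast
      then have "?R\<^sup>+\<^sup>+ x z"
        using w(1) p(2) unfolding A_def by (auto intro: tranclp_rtranclp_tranclp tranclp.trancl_into_trancl)
      then show False using z by (auto simp: A_def)
    qed
    then show "\<exists>r>0. C \<inter> mball z r \<subseteq> C - A"
      using \<delta>(1) by (intro exI[of _ \<delta>]) auto
  qed (use CM in auto)
  moreover have "topspace (subtopology mtopology C) = C" using CM by auto
  ultimately have "A = {} \<or> A = C"
    using connected_space_subtopology[OF con] unfolding connected_space_clopen_in closedin_def
    by (metis A_def Collect_subset)
  then show "?R\<^sup>+\<^sup>+ x y" using self xy by (auto simp: A_def)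
qed

end

section \<open>Morse sets and their connecting orbits\<close>

text \<open>The composite of the projection onto \<open>P\<close> with \<open>q\<close> sends each
  point to its cell in \<open>Q\<close>, so it is a quotient map; as the projection is one too, so
  is \<open>q\<close>.\<close>

lemma quotient_map_coarser_decomposition:
  assumes P: "partition_on (topspace X) P" and Q: "partition_on (topspace X) Q"
    and fine: "\<And>A. A \<in> P \<Longrightarrow> \<exists>B\<in>Q. A \<subseteq> B"
  obtains q where "quotient_map (decomposition_space X P) (decomposition_space X Q) q"
    "\<And>A. A \<in> P \<Longrightarrow> q A \<in> Q \<and> A \<subseteq> q A"
proof -
  have "\<forall>x\<in>topspace X. \<exists>A\<in>P. x \<in> A" using partition_onD1[OF P] by blast
  then obtain p where p: "\<And>x. x \<in> topspace X \<Longrightarrow> p x \<in> P \<and> x \<in> p x" by metis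
  obtain q where q: "\<And>A. A \<in> P \<Longrightarrow> q A \<in> Q \<and> A \<subseteq> q A" using fine by metis
  have "quotient_map X (decomposition_space X P) p"
    using quotient_map_decomposition_space[OF P p] .
  moreover have "quotient_map X (decomposition_space X Q) (q \<circ> p)"
    using p q by (intro quotient_map_decomposition_space[OF Q]) fastforce
  ultimately show ?thesis using q that quotient_map_compose_eq by metis
qed

locale compact_metric_flow = metric_flow M d v for M :: "'a set" and d v +
  assumes compact_space: "compact_space mtopology"
begin

abbreviation morse :: "'a set set" where
  "morse \<equiv> morse_sets M d v"

abbreviation connecting :: "'a set \<Rightarrow> 'a set \<Rightarrow> 'a set" where
  "connecting \<equiv> connecting_orbit_set mtopology v"

lemma morse_set_subset: "N \<in> morse \<Longrightarrow> N \<subseteq> chain_recurrent"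
  using connected_components_of_subset chain_recurrent_subset unfolding morse_sets_def by fastforce

lemma morse_set_nonempty: "N \<in> morse \<Longrightarrow> N \<noteq> {}"
  unfolding morse_sets_def by (rule nonempty_connected_components_of)

lemma connectedin_morse_set: "N \<in> morse \<Longrightarrow> connectedin mtopology N"
  using connectedin_connected_components_of unfolding morse_sets_def
  by (metis connectedin_subtopology)

lemma closedin_morse_set: "N \<in> morse \<Longrightarrow> closedin mtopology N"
  using closedin_connected_components_of closedin_trans_full[OF _ closedin_chain_recurrent]
  unfolding morse_sets_def by blast

lemma subset_morse_set:
  assumes "N \<in> morse" "connectedin mtopology C" "C \<subseteq> chain_recurrent" "x \<in> N" "x \<in> C"
  shows "C \<subseteq> N"
  using assms connected_components_of_maximal[of N "subtopology mtopology chain_recurrent" C]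
  by (auto simp: morse_sets_def connectedin_subtopology disjnt_iff)

lemma morse_set_unique: "N \<in> morse \<Longrightarrow> N' \<in> morse \<Longrightarrow> x \<in> N \<Longrightarrow> x \<in> N' \<Longrightarrow> N = N'"
  by (meson connectedin_morse_set morse_set_subset subset_antisym subset_morse_set)

lemma chain_recurrent_in_morse_set:
  assumes "x \<in> chain_recurrent"
  obtains N where "N \<in> morse" "x \<in> N"
proof -
  have "\<Union> morse = chain_recurrent"
    using Union_connected_components_of[of "subtopology mtopology chain_recurrent"] chain_recurrent_subset
    by (auto simp: morse_sets_def)
  then show ?thesis using assms that by blast
qed

lemma orbit_closure_subset_morse_set:
  assumes "N \<in> morse" "x \<in> N"
  shows "mtopology closure_of flow_orbit v x \<subseteq> N"
proof (rule closure_of_minimal[OF _ closedin_morse_set[OF assms(1)]])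
  have x: "x \<in> chain_recurrent" "x \<in> M" using assms morse_set_subset chain_recurrent_subset by blast+
  show "flow_orbit v x \<subseteq> N"
    using subset_morse_set[OF assms(1) connectedin_flow_orbit flow_orbit_subset_chain_recurrent assms(2)]
      x in_flow_orbit by simp
qed

lemma limit_sets_subset_morse_set:
  assumes "N \<in> morse" "x \<in> N"
  shows "alpha_limit mtopology v x \<subseteq> N" "omega_limit mtopology v x \<subseteq> N"
  using orbit_closure_subset_morse_set[OF assms] alpha_limit_subset_orbit_closure
    omega_limit_subset_orbit_closure by blast+

lemma alpha_nonempty: "x \<in> M \<Longrightarrow> alpha_limit mtopology v x \<noteq> {}"
  using alpha_limit_nonempty[OF compact_space] by simp

lemma omega_nonempty: "x \<in> M \<Longrightarrow> omega_limit mtopology v x \<noteq> {}"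
  using omega_limit_nonempty[OF compact_space] by simp

lemma limit_set_in_morse_set:
  assumes "L \<noteq> {}" "connectedin mtopology L" "L \<subseteq> chain_recurrent"
  obtains N where "N \<in> morse" "L \<subseteq> N"
proof -
  obtain x where x: "x \<in> L" using assms(1) by blast
  then obtain N where "N \<in> morse" "x \<in> N" using assms(3) chain_recurrent_in_morse_set by blast
  then show ?thesis using that subset_morse_set assms(2,3) x by blast
qed

lemma chain_recurrent_if_limit_sets_in_morse_set:
  assumes N: "N \<in> morse" and x: "x \<in> M"
    and "alpha_limit mtopology v x \<subseteq> N" "omega_limit mtopology v x \<subseteq> N"
  shows "x \<in> chain_recurrent"
proof -
  obtain a b where ab: "a \<in> alpha_limit mtopology v x" "b \<in> omega_limit mtopology v x"
    using alpha_nonempty[OF x] omega_nonempty[OF x] by blast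
  then have "chain_reach b a"
    using chain_reach_connected[OF connectedin_morse_set[OF N] morse_set_subset[OF N]] assms(3,4) by blast
  then have "chain_reach x x"
    using chain_reach_omega_limit[OF x ab(2)] chain_reach_alpha_limit[OF x ab(1)] chain_reach_trans by blast
  then show ?thesis using x by (simp add: chain_recurrent_iff)
qed

section \<open>Connecting orbit sets and the cells of the Morse graph\<close>

lemma in_connecting_iff:
  "x \<in> connecting N N' \<longleftrightarrow> x \<in> M \<and> alpha_limit mtopology v x \<subseteq> N \<and> omega_limit mtopology v x \<subseteq> N'"
  by (simp add: connecting_orbit_set_def)

text \<open>Since limit sets are nonempty, each determines the Morse set containing it; empty ones
  would fit into every Morse set.\<close>

lemma connecting_unique:
  assumes "x \<in> connecting N1 N2" "x \<in> connecting N1' N2'" "{N1, N2, N1', N2'} \<subseteq> morse"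
  shows "N1 = N1' \<and> N2 = N2'"
proof -
  have x: "x \<in> M" using assms by (simp add: in_connecting_iff)
  then obtain a b where "a \<in> alpha_limit mtopology v x" "b \<in> omega_limit mtopology v x"
    using alpha_nonempty omega_nonempty by blast
  then have "a \<in> N1" "a \<in> N1'" "b \<in> N2" "b \<in> N2'"
    using assms(1,2) unfolding in_connecting_iff by blast+
  then show ?thesis
    using assms(3) morse_set_unique[of N1 N1' a] morse_set_unique[of N2 N2' b] by blast
qed

text \<open>A point of \<open>N\<close> connects \<open>N\<close> to itself, so uniqueness forces
  both ends to be \<open>N\<close>. Arcs have distinct ends, hence their cells avoid all Morse
  sets.\<close>

lemma morse_set_connecting_disjoint:
  assumes "N \<in> morse" "x \<in> N" "x \<in> connecting N1 N2" "{N1, N2} \<subseteq> morse"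
  shows "N1 = N2"
proof -
  have "x \<in> connecting N N"
    using limit_sets_subset_morse_set[OF assms(1,2)] assms(3) by (simp add: in_connecting_iff)
  then show ?thesis using connecting_unique[OF assms(3)] assms(1,4) by blast
qed

lemma morse_arcs:
  "(N1, N2) \<in> parcs (morse_graph M d v) \<longleftrightarrow>
     N1 \<in> morse \<and> N2 \<in> morse \<and> N1 \<noteq> N2 \<and> connecting N1 N2 \<noteq> {}"
  by (simp add: morse_graph_def)

lemma morse_cells_eq:
  "morse_cells M d v = morse \<union> {connecting N1 N2 |N1 N2. (N1, N2) \<in> parcs (morse_graph M d v)}"
proof -
  have "morse_cell mtopology v ` Inl ` morse = morse"
    by (simp add: morse_cell_def image_image)
  moreover have "morse_cell mtopology v ` Inr ` E = {connecting N1 N2 |N1 N2. (N1, N2) \<in> E}" for E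
    unfolding image_image morse_cell_def by (auto intro!: image_eqI[of _ _ "(_, _)"])
  moreover have "pverts (morse_graph M d v) = morse" by (simp add: morse_graph_def)
  ultimately show ?thesis by (simp only: morse_cells_def Plus_def image_Un)
qed

lemma morse_cellE:
  assumes "B \<in> morse_cells M d v"
  obtains (vertex) "B \<in> morse"
  | (arc) N1 N2 where "(N1, N2) \<in> parcs (morse_graph M d v)" "B = connecting N1 N2"
  using assms unfolding morse_cells_eq by blast

lemma in_morse_cell:
  assumes "x \<in> M"
  obtains (vertex) N where "x \<in> chain_recurrent" "N \<in> morse" "x \<in> N"
  | (arc) N1 N2 where "x \<notin> chain_recurrent" "(N1, N2) \<in> parcs (morse_graph M d v)" "x \<in> connecting N1 N2"
proof (cases "x \<in> chain_recurrent")
  case True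
  then show ?thesis using chain_recurrent_in_morse_set vertex by blast
next
  case False
  have x: "x \<in> topspace mtopology" using assms by simp
  obtain N1 where N1: "N1 \<in> morse" "alpha_limit mtopology v x \<subseteq> N1"
    using limit_set_in_morse_set[OF alpha_nonempty[OF assms]
        connectedin_alpha_limit[OF compact_space x Hausdorff_space_mtopology]
        alpha_limit_subset_chain_recurrent[OF assms]] by blast
  obtain N2 where N2: "N2 \<in> morse" "omega_limit mtopology v x \<subseteq> N2"
    using limit_set_in_morse_set[OF omega_nonempty[OF assms]
        connectedin_omega_limit[OF compact_space x Hausdorff_space_mtopology]
        omega_limit_subset_chain_recurrent[OF assms]] by blast
  have "N1 \<noteq> N2" using chain_recurrent_if_limit_sets_in_morse_set[OF N1(1) assms N1(2)] N2 False by blast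
  moreover have "x \<in> connecting N1 N2" using N1 N2 assms by (simp add: in_connecting_iff)
  ultimately show ?thesis using arc[OF False] N1 N2 by (auto simp: morse_arcs)
qed

lemma morse_cell_unique:
  assumes "B \<in> morse_cells M d v" "B' \<in> morse_cells M d v" "x \<in> B" "x \<in> B'"
  shows "B = B'"
  using assms(1)
proof (cases rule: morse_cellE)
  case vertex
  note B = this
  show ?thesis using assms(2)
  proof (cases rule: morse_cellE)
    case vertex
    then show ?thesis using B assms morse_set_unique by blast
  next
    case (arc N1 N2)
    then show ?thesis using B assms morse_set_connecting_disjoint[of B x N1 N2] by (auto simp: morse_arcs)
  qed
next
  case (arc N1 N2)
  note B = this
  show ?thesis using assms(2)
  proof (cases rule: morse_cellE)
    case vertex
    then show ?thesis using B assms morse_set_connecting_disjoint[of B' x N1 N2] by (auto simp: morse_arcs)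
  next
    case (arc N1' N2')
    then show ?thesis using B assms connecting_unique[of x N1 N2 N1' N2'] by (auto simp: morse_arcs)
  qed
qed

lemma partition_on_morse_cells: "partition_on M (morse_cells M d v)"
proof (rule partition_onI)
  have "B \<subseteq> M" if "B \<in> morse_cells M d v" for B
    using that
  proof (cases rule: morse_cellE)
    case vertex
    then show ?thesis using morse_set_subset chain_recurrent_subset by blast
  qed (auto simp: in_connecting_iff)
  moreover have "\<exists>B\<in>morse_cells M d v. x \<in> B" if "x \<in> M" for x
    using that by (cases rule: in_morse_cell) (auto simp: morse_cells_eq)
  ultimately show "\<Union> (morse_cells M d v) = M" by blast
  show "disjnt B B'" if "B \<in> morse_cells M d v" "B' \<in> morse_cells M d v" "B \<noteq> B'" for B B'
    using morse_cell_unique that unfolding disjnt_iff by blast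
  show "{} \<notin> morse_cells M d v"
    using morse_set_nonempty by (auto simp: morse_cells_eq morse_arcs)
qed

text \<open>The points of \<open>morse_graph_space\<close> are subsets of the phase space.
  Injectivity lets them be read as vertices and arcs without two of these being identified.\<close>

lemma inj_on_morse_cell:
  "inj_on (morse_cell mtopology v) (pverts (morse_graph M d v) <+> parcs (morse_graph M d v))"
proof (rule inj_onI)
  have vert: "pverts (morse_graph M d v) = morse" by (simp add: morse_graph_def)
  have mixed: "connecting N1 N2 \<notin> morse" if "(N1, N2) \<in> parcs (morse_graph M d v)" for N1 N2
  proof
    assume N: "connecting N1 N2 \<in> morse"
    obtain x where "x \<in> connecting N1 N2" using morse_set_nonempty[OF N] by blast
    then show False
      using that morse_set_connecting_disjoint[OF N, of x N1 N2] by (auto simp: morse_arcs)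
  qed
  have arcs: "N1 = N1' \<and> N2 = N2'"
    if "(N1, N2) \<in> parcs (morse_graph M d v)" "(N1', N2') \<in> parcs (morse_graph M d v)"
      "connecting N1 N2 = connecting N1' N2'" for N1 N2 N1' N2'
    using that connecting_unique[of _ N1 N2 N1' N2'] unfolding morse_arcs by blast
  fix a b
  assume "a \<in> pverts (morse_graph M d v) <+> parcs (morse_graph M d v)"
    "b \<in> pverts (morse_graph M d v) <+> parcs (morse_graph M d v)"
    "morse_cell mtopology v a = morse_cell mtopology v b"
  then show "a = b"
    unfolding vert by (auto simp: morse_cell_def mixed dest: mixed arcs)
qed

section \<open>Each class lies in a single cell\<close>

lemma morse_cell_absorbs_orbit_class:
  assumes x: "x \<in> M"
  shows "\<exists>B\<in>morse_cells M d v. orbit_class mtopology v x \<subseteq> B"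
proof -
  have self: "y \<in> mtopology closure_of flow_orbit v y" if "y \<in> M" for y
    using closure_of_subset[OF flow_orbit_subset_topspace] in_flow_orbit that by auto
  show ?thesis using x
  proof (cases rule: in_morse_cell)
    case (vertex N)
    have "orbit_class mtopology v x \<subseteq> N"
      using orbit_closure_subset_morse_set[OF vertex(2,3)] self by (auto simp: orbit_class_def)
    then show ?thesis using vertex by (auto simp: morse_cells_eq)
  next
    case (arc N1 N2)
    have "orbit_class mtopology v x \<subseteq> connecting N1 N2"
    proof
      fix y assume "y \<in> orbit_class mtopology v x"
      then have y: "y \<in> M" and eq: "mtopology closure_of flow_orbit v y = mtopology closure_of flow_orbit v x"
        by (auto simp: orbit_class_def)
      \<comment> \<open>Closed invariant Morse sets make this symmetric: a Morse set through
        \<open>y\<close> contains the orbit closure of \<open>y\<close>, which is that of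
        \<open>x\<close>. Then \<open>y\<close> is in neither limit set of \<open>x\<close>, and
        only the orbit of \<open>x\<close> is left.\<close>
      have "y \<notin> chain_recurrent"
      proof
        assume "y \<in> chain_recurrent"
        then obtain N where N: "N \<in> morse" "y \<in> N" by (rule chain_recurrent_in_morse_set)
        then have "x \<in> N" using orbit_closure_subset_morse_set[OF N] self[OF x] eq by blast
        then show False using arc(1) N morse_set_subset by blast
      qed
      moreover have "y \<in> alpha_limit mtopology v x \<union> flow_orbit v x \<union> omega_limit mtopology v x"
        using orbit_closure_eq[OF Hausdorff_space_mtopology, of x] x self[OF y] eq by simp
      ultimately have "y \<in> flow_orbit v x"
        using alpha_limit_subset_chain_recurrent[OF x] omega_limit_subset_chain_recurrent[OF x] by blast
      then obtain t where "y = v t x" by (rule flow_orbit_cases)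
      then show "y \<in> connecting N1 N2"
        using arc(3) alpha_limit_flow[of x t] omega_limit_flow[of x t] x y by (simp add: in_connecting_iff)
    qed
    then show ?thesis using arc by (auto simp: morse_cells_eq)
  qed
qed

lemma subset_morse_cell_if_connected_chain_recurrent:
  assumes "connectedin mtopology C" "C \<subseteq> chain_recurrent" "x \<in> C"
  shows "\<exists>B\<in>morse_cells M d v. C \<subseteq> B"
proof -
  obtain N where "N \<in> morse" "x \<in> N" using assms chain_recurrent_in_morse_set by blast
  then show ?thesis using subset_morse_set[OF _ assms(1,2) _ assms(3)] by (auto simp: morse_cells_eq)
qed

lemma recurrent_points_subset_chain_recurrent: "recurrent_points mtopology v \<subseteq> chain_recurrent"
proof
  fix x assume "x \<in> recurrent_points mtopology v"
  then have "x \<in> M" "x \<in> alpha_limit mtopology v x \<union> omega_limit mtopology v x"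
    by (auto simp: recurrent_points_def)
  then show "x \<in> chain_recurrent"
    using alpha_limit_subset_chain_recurrent[of x] omega_limit_subset_chain_recurrent[of x] by blast
qed

text \<open>Limit sets are invariant, so one that met the orbit of \<open>x\<close> would contain
  \<open>x\<close> itself and make it recurrent. Removing the orbit therefore removes
  nothing.\<close>

lemma nonrecurrent_limit_sets:
  assumes "x \<in> nonrecurrent_points mtopology v"
  shows "alpha_limit' mtopology v x = alpha_limit mtopology v x"
    and "omega_limit' mtopology v x = omega_limit mtopology v x"
proof -
  have x: "x \<in> topspace mtopology" "x \<notin> alpha_limit mtopology v x" "x \<notin> omega_limit mtopology v x"
    using assms by (auto simp: nonrecurrent_points_def recurrent_points_def)
  have "v t x \<notin> alpha_limit mtopology v x \<and> v t x \<notin> omega_limit mtopology v x" for t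
    using x flow_in_alpha_limit[OF x(1), of "v t x" "- t"] flow_in_omega_limit[OF x(1), of "v t x" "- t"]
    by (auto simp: flow_minus)
  then show "alpha_limit' mtopology v x = alpha_limit mtopology v x"
    "omega_limit' mtopology v x = omega_limit mtopology v x"
    by (auto simp: alpha_limit'_def omega_limit'_def flow_orbit_def)
qed

lemma morse_cell_absorbs_limit_stratum_component:
  assumes x: "x \<in> M" and not: "x \<notin> nonclosed_recurrent_points mtopology v"
  shows "\<exists>B\<in>morse_cells M d v. limit_stratum_component mtopology v x \<subseteq> B"
proof -
  let ?C = "limit_stratum_component mtopology v x"
  have xC: "x \<in> ?C" using in_limit_stratum_component x by simp
  have C: "?C \<subseteq> M" using limit_stratum_component_subset limit_component_subset by fastforce
  have cell: ?thesis if "?C \<subseteq> chain_recurrent"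
    using subset_morse_cell_if_connected_chain_recurrent[OF connectedin_limit_stratum_component that xC] .
  show ?thesis
  proof (cases "x \<in> closed_orbit_points mtopology v")
    case True
    then have "recurrence_stratum mtopology v x \<subseteq> closed_orbit_points mtopology v"
      by (auto simp: recurrence_stratum_def closed_orbit_points_def)
    then have "?C \<subseteq> chain_recurrent"
      using limit_stratum_component_subset closed_orbit_points_subset_recurrent
        recurrent_points_subset_chain_recurrent by blast
    then show ?thesis by (rule cell)
  next
    case False
    then have xP: "x \<in> nonrecurrent_points mtopology v"
      using not x by (auto simp: nonclosed_recurrent_points_def nonrecurrent_points_def)
    then have "recurrence_stratum mtopology v x = nonrecurrent_points mtopology v"
      using False by (auto simp: recurrence_stratum_def closed_orbit_points_def)
    then have "?C \<subseteq> nonrecurrent_points mtopology v" using limit_stratum_component_subset by blast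
    moreover have "alpha_limit' mtopology v y = alpha_limit' mtopology v x \<and>
        omega_limit' mtopology v y = omega_limit' mtopology v x" if "y \<in> ?C" for y
      using that limit_stratum_component_subset[of x] limit_component_subset[of x] by auto
    ultimately have eq: "alpha_limit mtopology v y = alpha_limit mtopology v x \<and>
        omega_limit mtopology v y = omega_limit mtopology v x" if "y \<in> ?C" for y
      using that nonrecurrent_limit_sets xP by (metis subsetD)
    show ?thesis using x
    proof (cases rule: in_morse_cell)
      case (vertex N)
      \<comment> \<open>A non-recurrent point can still be chain recurrent. In that case the limit
        sets of all members lie in the Morse set \<open>N\<close> of \<open>x\<close>, so every
        member is chain recurrent as well, and connectedness puts them into one cell.\<close>
      have "?C \<subseteq> chain_recurrent"
        using eq limit_sets_subset_morse_set[OF vertex(2,3)] C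
          chain_recurrent_if_limit_sets_in_morse_set[OF vertex(2)] by (metis subset_iff)
      then show ?thesis by (rule cell)
    next
      case (arc N1 N2)
      then have "?C \<subseteq> connecting N1 N2" using eq C by (auto simp: in_connecting_iff)
      then show ?thesis using arc by (auto simp: morse_cells_eq)
    qed
  qed
qed

lemma morse_cell_absorbs_class:
  assumes P: "P \<in> {abstract_weak_orbits mtopology v, weak_orbit_classes mtopology v, orbit_classes mtopology v}"
    and A: "A \<in> P"
  shows "\<exists>B\<in>morse_cells M d v. A \<subseteq> B"
proof -
  have weak: "\<exists>B\<in>morse_cells M d v. weak_orbit_class mtopology v x \<subseteq> B" if "x \<in> M" for x
    using morse_cell_absorbs_orbit_class[OF that] weak_orbit_class_subset_orbit_class by (meson order_trans)
  have "\<exists>B\<in>morse_cells M d v. abstract_weak_orbit mtopology v x \<subseteq> B" if "x \<in> M" for x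
    using weak[OF that] morse_cell_absorbs_limit_stratum_component[OF that]
    by (simp add: abstract_weak_orbit_def)
  then show ?thesis
    using P A weak morse_cell_absorbs_orbit_class
    by (auto simp: abstract_weak_orbits_def weak_orbit_classes_def orbit_classes_def)
qed

section \<open>Images of the pre-orders in the Morse graph\<close>

text \<open>The argument is the same for both orders: \<open>h\<close> selects the tail when
  \<open>L\<close> is the \<alpha>-limit and the head when it is the \<omega>-limit. Every arc is
  attained, because its cell has a point \<open>b\<close>, and the nonempty \<open>L b\<close>
  supplies a point in the Morse set at the selected end.\<close>

lemma image_limit_relation:
  assumes P: "partition_on M P"
    and q: "\<And>A. A \<in> P \<Longrightarrow> q A \<in> morse_cells M d v \<and> A \<subseteq> q A"
    and L: "\<And>x. x \<in> M \<Longrightarrow> L x \<noteq> {} \<and> L x \<subseteq> M"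
      "\<And>N x. N \<in> morse \<Longrightarrow> x \<in> N \<Longrightarrow> L x \<subseteq> N"
    and h: "\<And>N1 N2. N1 \<in> morse \<Longrightarrow> N2 \<in> morse \<Longrightarrow> h N1 N2 \<in> morse"
      "\<And>N1 N2 x. x \<in> connecting N1 N2 \<Longrightarrow> L x \<subseteq> h N1 N2"
  shows "map_prod q q ` {(A, B) \<in> P \<times> P. A = B \<or> (\<exists>a\<in>A. \<exists>b\<in>B. a \<in> L b)} =
    Id_on (morse_cells M d v) \<union>
      {(h N1 N2, connecting N1 N2) |N1 N2. (N1, N2) \<in> parcs (morse_graph M d v)}" (is "?lhs = ?rhs")
proof
  have q_eq: "q A = B" if "A \<in> P" "B \<in> morse_cells M d v" "x \<in> A" "x \<in> B" for A B x
    using morse_cell_unique[of "q A" B x] q[OF that(1)] that by blast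
  have cls: "\<exists>A\<in>P. x \<in> A" if "x \<in> M" for x using partition_onD1[OF P] that by blast
  have hM: "h N1 N2 \<in> morse_cells M d v" if "(N1, N2) \<in> parcs (morse_graph M d v)" for N1 N2
    using h(1) that by (auto simp: morse_cells_eq morse_arcs)
  show "?lhs \<subseteq> ?rhs"
  proof
    fix z assume "z \<in> ?lhs"
    then obtain A B where z: "z = (q A, q B)"
      and AB: "A \<in> P" "B \<in> P" "A = B \<or> (\<exists>a\<in>A. \<exists>b\<in>B. a \<in> L b)"
      by auto
    show "z \<in> ?rhs"
    proof (cases "A = B")
      case True
      then show ?thesis using q[OF AB(1)] by (auto simp: z)
    next
      case False
      then obtain a b where ab: "a \<in> A" "b \<in> B" "a \<in> L b" using AB(3) by blast
      have "q B \<in> morse_cells M d v" "b \<in> q B" using q[OF AB(2)] ab by auto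
      then show ?thesis
      proof (cases rule: morse_cellE)
        case vertex
        \<comment> \<open>Limit sets of points of a Morse set stay in it, so over a vertex the
          relation between classes collapses to the diagonal.\<close>
        then have "a \<in> q B" using L(2) \<open>b \<in> q B\<close> ab(3) by blast
        then show ?thesis
          using q_eq[OF AB(1) _ ab(1)] \<open>q B \<in> morse_cells M d v\<close> by (auto simp: z)
      next
        case (arc N1 N2)
        then have "a \<in> h N1 N2" using h(2) \<open>b \<in> q B\<close> ab(3) by blast
        then have "q A = h N1 N2" using q_eq[OF AB(1) hM ab(1)] arc by blast
        then show ?thesis using arc by (auto simp: z)
      qed
    qed
  qed
  show "?rhs \<subseteq> ?lhs"
  proof
    fix z assume "z \<in> ?rhs"
    then consider (cell) B where "B \<in> morse_cells M d v" "z = (B, B)"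
      | (arc) N1 N2 where "(N1, N2) \<in> parcs (morse_graph M d v)" "z = (h N1 N2, connecting N1 N2)"
      by auto
    then show "z \<in> ?lhs"
    proof cases
      case cell
      then obtain x where x: "x \<in> B" "x \<in> M"
        using partition_on_morse_cells partition_onD1 partition_onD3 by (metis UnionI ex_in_conv)
      then obtain A where A: "A \<in> P" "x \<in> A" using cls by blast
      then have "q A = B" using q_eq cell x by blast
      then show ?thesis using A cell by (intro image_eqI[of _ _ "(A, A)"]) auto
    next
      case arc
      then obtain b where b: "b \<in> connecting N1 N2" by (auto simp: morse_arcs)
      then have bM: "b \<in> M" by (simp add: in_connecting_iff)
      then obtain a where a: "a \<in> L b" "a \<in> M" using L(1) by blast
      obtain A B where AB: "A \<in> P" "a \<in> A" "B \<in> P" "b \<in> B" using cls a bM by blast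
      have "q A = h N1 N2" using q_eq[OF AB(1) hM AB(2)] arc(1) h(2)[OF b] a(1) by blast
      moreover have "connecting N1 N2 \<in> morse_cells M d v" using arc(1) by (auto simp: morse_cells_eq)
      then have "q B = connecting N1 N2" using q_eq[OF AB(3) _ AB(4)] b by blast
      ultimately show ?thesis using AB a arc by (intro image_eqI[of _ _ "(A, B)"]) auto
    qed
  qed
qed

lemma morse_graph_quotient:
  assumes P: "P \<in> {abstract_weak_orbits mtopology v, weak_orbit_classes mtopology v, orbit_classes mtopology v}"
  obtains q where "quotient_map (decomposition_space mtopology P) (morse_graph_space M d v) q"
    "\<And>A. A \<in> P \<Longrightarrow> A \<subseteq> q A"
    "map_prod q q ` le_alpha mtopology v P = morse_tail_rel M d v"
    "map_prod q q ` le_omega mtopology v P = morse_head_rel M d v"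
proof -
  have part: "partition_on M P"
    using partition_on_flow_classes[OF Hausdorff_space_mtopology P] by simp
  obtain q where quot: "quotient_map (decomposition_space mtopology P) (morse_graph_space M d v) q"
    and q: "\<And>A. A \<in> P \<Longrightarrow> q A \<in> morse_cells M d v \<and> A \<subseteq> q A"
    unfolding morse_graph_space_def
    using quotient_map_coarser_decomposition[of mtopology P "morse_cells M d v"] part
      partition_on_morse_cells morse_cell_absorbs_class[OF P] by auto
  have "map_prod q q ` le_alpha mtopology v P = morse_tail_rel M d v"
    unfolding le_alpha_def morse_tail_rel_def
    using alpha_limit_subset_topspace alpha_nonempty limit_sets_subset_morse_set
    by (intro image_limit_relation[OF part q, where h = "\<lambda>N1 N2. N1"]) (auto simp: in_connecting_iff)
  moreover have "map_prod q q ` le_omega mtopology v P = morse_head_rel M d v"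
    unfolding le_omega_def morse_head_rel_def
    using omega_limit_subset_topspace omega_nonempty limit_sets_subset_morse_set
    by (intro image_limit_relation[OF part q, where h = "\<lambda>N1 N2. N2"]) (auto simp: in_connecting_iff)
  ultimately show ?thesis using that quot q by blast
qed

end

text \<open>The directed structure appears as two equalities of images rather than inclusions: the
  pre-orders descend to incidence with tails and heads and also produce every incidence of the
  graph. The condition \<open>A \<subseteq> q A\<close> makes \<open>q\<close> the map induced by
  the identity of the phase space.\<close>

theorem corollary5p19:
  fixes S :: "'a set" and d :: "'a \<Rightarrow> 'a \<Rightarrow> real" and v :: "real \<Rightarrow> 'a \<Rightarrow> 'a"
  defines "X \<equiv> Metric_space.mtopology S d"
  assumes "Metric_space S d"
    and "compact_space X"
    and "flow_on X v"
  shows "partition_on S (morse_cells S d v) \<and>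
    inj_on (morse_cell X v) (pverts (morse_graph S d v) <+> parcs (morse_graph S d v)) \<and>
    (\<forall>P \<in> {abstract_weak_orbits X v, weak_orbit_classes X v, orbit_classes X v}.
       partition_on S P \<and>
       preorder_on P (le_alpha X v P) \<and>
       preorder_on P (le_omega X v P) \<and>
       (\<exists>q. quotient_map (decomposition_space X P) (morse_graph_space S d v) q \<and>
            (\<forall>A\<in>P. A \<subseteq> q A) \<and>
            map_prod q q ` le_alpha X v P = morse_tail_rel S d v \<and>
            map_prod q q ` le_omega X v P = morse_head_rel S d v))"
proof -
  interpret Metric_space S d by (rule assms(2))
  interpret compact_metric_flow S d v
    using assms(3,4) unfolding X_def by unfold_locales
  show ?thesis
    unfolding X_def
  proof (intro conjI ballI)
    fix P assume P: "P \<in> {abstract_weak_orbits mtopology v, weak_orbit_classes mtopology v, orbit_classes mtopology v}"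
    show "partition_on S P"
      using partition_on_flow_classes[OF Hausdorff_space_mtopology P] by simp
    show "preorder_on P (le_alpha mtopology v P)" "preorder_on P (le_omega mtopology v P)"
      using preorder_on_le_alpha[OF Hausdorff_space_mtopology P]
        preorder_on_le_omega[OF Hausdorff_space_mtopology P] .
    show "\<exists>q. quotient_map (decomposition_space mtopology P) (morse_graph_space S d v) q \<and>
        (\<forall>A\<in>P. A \<subseteq> q A) \<and>
        map_prod q q ` le_alpha mtopology v P = morse_tail_rel S d v \<and>
        map_prod q q ` le_omega mtopology v P = morse_head_rel S d v"
      using morse_graph_quotient[OF P] by metis
  qed (rule partition_on_morse_cells inj_on_morse_cell)+
qed

end
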